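(* Assume that every $g\in\Omega$ belongs to only finitely many sets $\Omega_k$, and that there exists $m\in\mathbb{N}$ such that either $\Omega=\bigcup_{j=1}^m\Omega_j$, or none of the sets $\Omega_k$ with $k>m$ lies in the union of a finite collection of other sets $\Omega_j\in\Gamma$. Let $\mathfrak{T}$ be any locally convex topology on $\mathcal{W}$ such that (i) every continuous linear functional on $(\mathcal{W},\mathfrak{T})$ is of the form $w\mapsto\langle w,w'\rangle$ for some $w'\in\mathcal{W}'$, and (ii) all the functionals $w\mapsto\sum_{g\in\Omega_k}w(g)$, $k=1,2,\ldots$, are $\mathfrak{T}$-continuous. Then $$\mathcal{S}(\Gamma,\mathcal{W})=\overline{\mathrm{conv}}\,\mathrm{ex}\,\mathcal{S}(\Gamma,\mathcal{W}),$$ where the closure is taken in $\mathfrak{T}$.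
   Context: Let $\Gamma=\{\Omega_1,\Omega_2,\ldots\}$ be a finite or countably infinite family of countable sets (possibly intersecting), $\Omega:=\bigcup_k\Omega_k$, with the standing assumption $\Omega_k\setminus\Omega_j\ne\varnothing$ for $j\ne k$. $\mathcal{S}(\Gamma)$ (resp. $\mathcal{S}^0(\Gamma)$) is the set of nonnegative functions $w$ on $\Omega$ with $\sum_{g\in\Omega_k}w(g)=1$ (resp. $\le1$) for all $k$; $\mathcal{P}^0(\Gamma)$ is the set of functions in $\mathcal{S}^0(\Gamma)$ taking only the values $0,1$. $\mathcal{W}$ is a linear space of real-valued functions on $\Omega$ containing $\mathcal{P}^0(\Gamma)$ and such that $w\in\mathcal{W}$, $|\tilde w|\le|w|$ imply $\tilde w\in\mathcal{W}$. $\mathcal{S}(\Gamma,\mathcal{W}):=\mathcal{S}(\Gamma)\cap\mathcal{W}$; $\mathrm{ex}\,A$ is the set of extreme points of $A$, $\mathrm{conv}\,A$ its convex hull and $\overline{\mathrm{conv}}\,A$ the closure of $\mathrm{conv}\,A$. $\mathcal{W}'$ is the space of real-valued functions $w'$ on $\Omega$ with $\sum_{g\in\Omega}|w(g)w'(g)|<\infty$ for all $w\in\mathcal{W}$, and $\langle w,w'\rangle:=\sum_{g\in\Omega}w(g)w'(g)$.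
   Formalization: The inclusion of S(Γ,W) in the closure of conv ex S(Γ,W) is proved as stated; equality is proved when, in addition, all evaluations w ↦ w(g) are T-continuous, since (i) and (ii) alone do not make S(Γ,W) closed. *)

theory Defs
  imports "HOL-Analysis.Analysis" "HOL-Library.Function_Algebras"
begin

text \<open>
  The pointwise vector space structure on functions, so that \<^const>\<open>subspace\<close>,
  \<^const>\<open>convex\<close>, \<^const>\<open>extreme_point_of\<close> and the convex hull of the library apply.
  The product topology that the library puts on function types plays no role below:
  all topologies are given explicitly as values of type \<open>_ topology\<close>.
\<close>

instantiation "fun" :: (type, real_vector) real_vector
begin

definition scaleR_fun_def: "scaleR c f = (\<lambda>x. c *\<^sub>R f x)"

instance
  by standard (simp_all add: scaleR_fun_def fun_eq_iff scaleR_add_right scaleR_add_left)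

end

lemma scaleR_fun_apply [simp]: "(c *\<^sub>R f) x = c *\<^sub>R f x"
  by (simp add: scaleR_fun_def)

text \<open>
  A family \<open>\<Gamma> = {\<Omega>\<^sub>1, \<Omega>\<^sub>2, \<dots>}\<close> is given by the index set \<open>I\<close>, which is \<open>{1..n}\<close> or all positive
  integers, and by the enumeration \<open>Om\<close>.
\<close>

definition set_family :: "nat set \<Rightarrow> (nat \<Rightarrow> 'a set) \<Rightarrow> bool" where
  "set_family I Om \<longleftrightarrow>
     (I = {1..} \<or> (\<exists>n\<ge>1. I = {1..n})) \<and>
     (\<forall>k\<in>I. countable (Om k)) \<and>
     (\<forall>j\<in>I. \<forall>k\<in>I. j \<noteq> k \<longrightarrow> Om k - Om j \<noteq> {})"

definition ground :: "nat set \<Rightarrow> (nat \<Rightarrow> 'a set) \<Rightarrow> 'a set" where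
  "ground I Om = (\<Union>k\<in>I. Om k)"

text \<open>Real functions on \<open>X\<close> are represented by their extensions by zero to the whole type.\<close>

definition functions_on :: "'a set \<Rightarrow> ('a \<Rightarrow> real) set" where
  "functions_on X = {w. \<forall>g. g \<notin> X \<longrightarrow> w g = 0}"

definition stochastic :: "nat set \<Rightarrow> (nat \<Rightarrow> 'a set) \<Rightarrow> ('a \<Rightarrow> real) set" where
  "stochastic I Om = {w \<in> functions_on (ground I Om).
     (\<forall>g. 0 \<le> w g) \<and> (\<forall>k\<in>I. (w has_sum 1) (Om k))}"

definition substochastic :: "nat set \<Rightarrow> (nat \<Rightarrow> 'a set) \<Rightarrow> ('a \<Rightarrow> real) set" where
  "substochastic I Om = {w \<in> functions_on (ground I Om).
     (\<forall>g. 0 \<le> w g) \<and> (\<forall>k\<in>I. w summable_on Om k \<and> (\<Sum>\<^sub>\<infinity>g\<in>Om k. w g) \<le> 1)}"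

definition subpermutation :: "nat set \<Rightarrow> (nat \<Rightarrow> 'a set) \<Rightarrow> ('a \<Rightarrow> real) set" where
  "subpermutation I Om = {w \<in> substochastic I Om. \<forall>g. w g \<in> {0, 1}}"

definition admissible_space ::
  "nat set \<Rightarrow> (nat \<Rightarrow> 'a set) \<Rightarrow> ('a \<Rightarrow> real) set \<Rightarrow> bool" where
  "admissible_space I Om W \<longleftrightarrow>
     W \<subseteq> functions_on (ground I Om) \<and> subspace W \<and> subpermutation I Om \<subseteq> W \<and>
     (\<forall>w\<in>W. \<forall>v\<in>functions_on (ground I Om). (\<forall>g. \<bar>v g\<bar> \<le> \<bar>w g\<bar>) \<longrightarrow> v \<in> W)"

definition dual_functions :: "'a set \<Rightarrow> ('a \<Rightarrow> real) set \<Rightarrow> ('a \<Rightarrow> real) set" where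
  "dual_functions X W =
     {w' \<in> functions_on X. \<forall>w\<in>W. (\<lambda>g. \<bar>w g * w' g\<bar>) summable_on X}"

definition pairing :: "'a set \<Rightarrow> ('a \<Rightarrow> real) \<Rightarrow> ('a \<Rightarrow> real) \<Rightarrow> real" where
  "pairing X w w' = (\<Sum>\<^sub>\<infinity>g\<in>X. w g * w' g)"

text \<open>The Hausdorff property is not part of the definition.\<close>

definition locally_convex_topology :: "'v::real_vector set \<Rightarrow> 'v topology \<Rightarrow> bool" where
  "locally_convex_topology W T \<longleftrightarrow>
     subspace W \<and> topspace T = W \<and>
     continuous_map (prod_topology T T) T (\<lambda>(x, y). x + y) \<and>
     continuous_map (prod_topology euclideanreal T) T (\<lambda>(c, x). c *\<^sub>R x) \<and>
     (\<forall>U. openin T U \<and> 0 \<in> U \<longrightarrow> (\<exists>V. openin T V \<and> convex V \<and> 0 \<in> V \<and> V \<subseteq> U))"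

definition continuous_functional ::
  "'v::real_vector set \<Rightarrow> 'v topology \<Rightarrow> ('v \<Rightarrow> real) \<Rightarrow> bool" where
  "continuous_functional W T \<phi> \<longleftrightarrow>
     (\<forall>x\<in>W. \<forall>y\<in>W. \<phi> (x + y) = \<phi> x + \<phi> y) \<and>
     (\<forall>c. \<forall>x\<in>W. \<phi> (c *\<^sub>R x) = c * \<phi> x) \<and>
     continuous_map T euclideanreal \<phi>"

text \<open>
  \<open>T\<close> is at least as fine as the topology of pointwise convergence on \<open>X\<close>.  This does not
  follow from the other conditions on \<open>T\<close>, and without it the stochastic functions in \<open>W\<close> need
  not be \<open>T\<close>-closed.  Example: \<open>\<Gamma> = {\<nat>}\<close>, \<open>W = \<ell>\<^sup>1\<close>, \<open>D\<close> the space of convergent sequences \<open>d\<close>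
  with \<open>lim d = 2 d(1) - d(0)\<close>, and \<open>T\<close> the weak topology \<open>\<sigma>(\<ell>\<^sup>1, D)\<close>, which is Hausdorff.  Every
  continuous functional is given by an element of \<open>D \<subseteq> \<ell>\<^sup>\<infinity> = W'\<close>, and the sum over \<open>\<nat>\<close> is
  continuous because \<open>1 \<in> D\<close>.  But the unit vectors \<open>e\<^sub>n\<close>, which are the extreme points of the
  set of stochastic functions, converge in \<open>T\<close> to \<open>2 e\<^sub>1 - e\<^sub>0\<close>, which has a negative value.
\<close>

definition finer_than_pointwise :: "'a set \<Rightarrow> ('a \<Rightarrow> real) topology \<Rightarrow> bool" where
  "finer_than_pointwise X T \<longleftrightarrow> (\<forall>g\<in>X. continuous_map T euclideanreal (\<lambda>w. w g))"

end

theory Submission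
  imports Defs
begin

text \<open>
  By Hahn-Banach separation it suffices to find, for a stochastic \<open>w\<close> in \<open>W\<close>, for \<open>w'\<close> in the
  dual space and for \<open>\<epsilon> > 0\<close>, one extreme point \<open>v\<close> with \<open>\<langle>v, w'\<rangle> \<ge> \<langle>w, w'\<rangle> - \<epsilon>\<close>.  If \<open>\<Omega>\<close> is
  a finite union of the \<open>\<Omega>\<^sub>k\<close>, then \<open>w\<close> has finite total mass, which forces the family to be
  finite, so only the second alternative for the tail matters.  Take \<open>n\<close> large and keep the part of \<open>w\<close> on
  \<open>\<Omega>\<^sub>1 \<union> \<dots> \<union> \<Omega>\<^sub>n\<close>.  Merging almost all of its points by type (the low sets that contain them)
  makes the support finite without changing the first \<open>n\<close> sums, without spoiling the other
  inequalities and without lowering the pairing with \<open>w'\<close>.  The functions of this kind on the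
  finite support form a polytope, which has an extreme point \<open>e\<close> at least as good.  Finally \<open>e\<close>
  is completed to a stochastic function with one new point \<open>g\<^sub>k \<in> \<Omega>\<^sub>k\<close> for each \<open>k > n\<close>, chosen
  outside finitely many other sets so that the values at the \<open>g\<^sub>k\<close> are determined recursively by
  \<open>e\<close>; hence the completion is again extreme.  The points \<open>g\<^sub>k\<close> can be chosen with
  \<open>\<Sum>\<^sub>k \<bar>w' g\<^sub>k\<bar> \<le> \<epsilon>/2\<close>, because a sequence of expensive ones would give a function in \<open>W\<close> on which
  \<open>w'\<close> is not summable.
\<close>

subsection \<open>Hahn-Banach separation for a locally convex topology on a subspace\<close>

text \<open>Homogeneity is only an inequality for positive factors, which is all that has to be
  checked for an infimum. Applying it to \<open>c\<close> and to its inverse gives equality.\<close>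

definition sublinear_on :: "'v::real_vector set \<Rightarrow> ('v \<Rightarrow> real) \<Rightarrow> bool" where
  "sublinear_on W q \<longleftrightarrow>
     (\<forall>x\<in>W. \<forall>y\<in>W. q (x + y) \<le> q x + q y) \<and> (\<forall>x\<in>W. \<forall>c>0. q (c *\<^sub>R x) \<le> c * q x)"

lemma sublinear_onD:
  assumes "sublinear_on W q"
  shows "x \<in> W \<Longrightarrow> y \<in> W \<Longrightarrow> q (x + y) \<le> q x + q y"
    and "x \<in> W \<Longrightarrow> c > 0 \<Longrightarrow> q (c *\<^sub>R x) \<le> c * q x"
  using assms by (auto simp: sublinear_on_def)

lemma sublinear_on_0:
  assumes "sublinear_on W q" "subspace W"
  shows "q 0 = 0"
  using sublinear_onD(2)[OF assms(1) subspace_0[OF assms(2)], of 2]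
    sublinear_onD(2)[OF assms(1) subspace_0[OF assms(2)], of "1/2"] by simp

lemma sublinear_on_scaleR:
  assumes "sublinear_on W q" "subspace W" "x \<in> W" "c \<ge> 0"
  shows "q (c *\<^sub>R x) = c * q x"
proof (cases "c = 0")
  case True
  then show ?thesis using sublinear_on_0[OF assms(1,2)] by simp
next
  case False
  then have c: "c > 0" using assms by simp
  have "q (inverse c *\<^sub>R (c *\<^sub>R x)) \<le> inverse c * q (c *\<^sub>R x)"
    using c by (intro sublinear_onD(2)[OF assms(1)] subspace_scale[OF assms(2,3)]) auto
  then have "c * q x \<le> q (c *\<^sub>R x)" using c by (simp add: field_simps)
  then show ?thesis using sublinear_onD(2)[OF assms(1,3) c] by simp
qed

lemma sublinear_on_minus:
  assumes "sublinear_on W q" "subspace W" "x \<in> W"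
  shows "- q (- x) \<le> q x"
  using sublinear_onD(1)[OF assms(1,3) subspace_neg[OF assms(2,3)]] sublinear_on_0[OF assms(1,2)]
  by simp

text \<open>Take the infimum over \<open>t \<ge> 0\<close> of
  \<open>q (x + t *\<^sub>R y) - t * q y\<close>. The term at \<open>t = 0\<close> gives
  \<open>r \<le> q\<close>, and at \<open>x = - y\<close> the term at \<open>t = 1\<close> is
  \<open>q 0 - q y = - q y\<close>. Subadditivity of \<open>q\<close> at
  \<open>x + t *\<^sub>R y\<close> and \<open>- x\<close> bounds the terms from below by
  \<open>- q (- x)\<close>, so the infimum is a real number.\<close>

lemma sublinear_on_reduce:
  assumes q: "sublinear_on W q" and W: "subspace W" and y: "y \<in> W"
  obtains r where "sublinear_on W r" "\<And>x. x \<in> W \<Longrightarrow> r x \<le> q x" "r (- y) \<le> - q y"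
proof -
  define r where "r x = (INF t\<in>{0..}. q (x + t *\<^sub>R y) - t * q y)" for x
  have inW: "x + t *\<^sub>R y \<in> W" if "x \<in> W" for x t
    by (intro subspace_add[OF W] subspace_scale[OF W] that y)
  have "- q (- x) \<le> q (x + t *\<^sub>R y) - t * q y" if "x \<in> W" "t \<ge> 0" for x t
  proof -
    have "q ((x + t *\<^sub>R y) + (- x)) \<le> q (x + t *\<^sub>R y) + q (- x)"
      by (intro sublinear_onD(1)[OF q] inW that subspace_neg[OF W])
    then show ?thesis using sublinear_on_scaleR[OF q W y] that by simp
  qed
  then have bdd: "bdd_below ((\<lambda>t. q (x + t *\<^sub>R y) - t * q y) ` {0..})" if "x \<in> W" for x
    using that by (intro bdd_belowI2[where m = "- q (- x)"]) auto
  have le: "r x \<le> q (x + t *\<^sub>R y) - t * q y" if "x \<in> W" "t \<ge> 0" for x t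
    unfolding r_def using that by (intro cINF_lower bdd) auto
  have ge: "c \<le> r x" if "\<And>t. t \<ge> 0 \<Longrightarrow> c \<le> q (x + t *\<^sub>R y) - t * q y" for x c
    unfolding r_def using that by (intro cINF_greatest) auto
  have sub: "sublinear_on W r"
    unfolding sublinear_on_def
  proof (intro conjI ballI allI impI)
    fix x z assume xz: "x \<in> W" "z \<in> W"
    have *: "r (x + z) \<le> (q (x + t *\<^sub>R y) - t * q y) + (q (z + s *\<^sub>R y) - s * q y)"
      if "t \<ge> 0" "s \<ge> 0" for t s
    proof -
      have "r (x + z) \<le> q (x + z + (t + s) *\<^sub>R y) - (t + s) * q y"
        using that xz subspace_add[OF W] by (intro le) auto
      also have "x + z + (t + s) *\<^sub>R y = (x + t *\<^sub>R y) + (z + s *\<^sub>R y)"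
        by (simp add: scaleR_add_left)
      also have "q \<dots> \<le> q (x + t *\<^sub>R y) + q (z + s *\<^sub>R y)"
        by (intro sublinear_onD(1)[OF q] inW xz)
      finally show ?thesis by (simp add: algebra_simps)
    qed
    have "r (x + z) - (q (z + s *\<^sub>R y) - s * q y) \<le> r x" if "s \<ge> 0" for s
      using *[OF _ that] by (intro ge) (simp add: algebra_simps)
    then have "r (x + z) - r x \<le> r z" by (intro ge) (simp add: algebra_simps)
    then show "r (x + z) \<le> r x + r z" by simp
  next
    fix x and c :: real assume x: "x \<in> W" and c: "c > 0"
    have "r (c *\<^sub>R x) / c \<le> r x"
    proof (intro ge)
      fix t :: real assume t: "t \<ge> 0"
      have "r (c *\<^sub>R x) \<le> q (c *\<^sub>R x + (c * t) *\<^sub>R y) - (c * t) * q y"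
        using c t subspace_scale[OF W x] by (intro le) auto
      also have "c *\<^sub>R x + (c * t) *\<^sub>R y = c *\<^sub>R (x + t *\<^sub>R y)" by (simp add: scaleR_add_right)
      also have "q \<dots> = c * q (x + t *\<^sub>R y)"
        using c by (intro sublinear_on_scaleR[OF q W] inW x) auto
      finally show "r (c *\<^sub>R x) / c \<le> q (x + t *\<^sub>R y) - t * q y"
        using c by (simp add: field_simps)
    qed
    then show "r (c *\<^sub>R x) \<le> c * r x" using c by (simp add: field_simps)
  qed
  show thesis
  proof (rule that[OF sub])
    show "r x \<le> q x" if "x \<in> W" for x using le[OF that, of 0] by simp
    show "r (- y) \<le> - q y"
      using le[OF subspace_neg[OF W y], of 1] sublinear_on_0[OF q W] by simp
  qed
qed

text \<open>
  Hahn-Banach without extending functionals step by step: by the preceding reduction, a pointwise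
  minimal sublinear functional is odd, hence linear.
\<close>

lemma minimal_sublinear_on:
  assumes p: "sublinear_on W p" and W: "subspace W"
  obtains q where "sublinear_on W q" "\<And>x. x \<in> W \<Longrightarrow> q x \<le> p x"
    "\<And>r x. \<lbrakk>sublinear_on W r; \<And>x. x \<in> W \<Longrightarrow> r x \<le> q x; x \<in> W\<rbrakk> \<Longrightarrow> r x = q x"
proof -
  \<comment> \<open>Values outside \<open>W\<close> are fixed to 0, so that for members of
    \<open>Z\<close> comparison everywhere means comparison on \<open>W\<close>. The order
    \<open>le\<close> is reversed: a maximal element for Zorn's lemma is a pointwise minimal
    functional.\<close>
  define Z where "Z = {q. sublinear_on W q \<and> (\<forall>x\<in>W. q x \<le> p x) \<and> (\<forall>x. x \<notin> W \<longrightarrow> q x = 0)}"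
  define le where "le q q' \<longleftrightarrow> (\<forall>x. q' x \<le> q x)" for q q' :: "'a \<Rightarrow> real"
  have restrict: "sublinear_on W (\<lambda>x. if x \<in> W then r x else 0)" if "sublinear_on W r" for r
    using that subspace_add[OF W] subspace_scale[OF W] by (auto simp: sublinear_on_def)
  have "partial_order_on Z (relation_of le Z)"
    by (rule partial_order_on_relation_ofI) (auto simp: le_def intro!: ext intro: order_trans order_antisym)
  moreover have "\<exists>u\<in>Z. \<forall>q\<in>C. le q u" if C: "C \<in> Chains (relation_of le Z)" for C
  proof (cases "C = {}")
    case True
    have "(\<lambda>x. if x \<in> W then p x else 0) \<in> Z" using restrict[OF p] by (auto simp: Z_def)
    then show ?thesis using True by auto
  next
    case False
    have CZ: "C \<subseteq> Z" using C by (auto simp: Chains_def relation_of_def)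
    have chain: "le q r \<or> le r q" if "q \<in> C" "r \<in> C" for q r
      using C that by (auto simp: Chains_def relation_of_def)
    define u where "u x = (if x \<in> W then INF q\<in>C. q x else 0)" for x
    have "- p (- x) \<le> q x" if "q \<in> C" "x \<in> W" for q x
    proof -
      have q: "sublinear_on W q" and *: "q (- x) \<le> p (- x)"
        using that CZ subspace_neg[OF W] by (auto simp: Z_def)
      show ?thesis using sublinear_on_minus[OF q W that(2)] * by simp
    qed
    then have bdd: "bdd_below ((\<lambda>q. q x) ` C)" if "x \<in> W" for x
      using that by (intro bdd_belowI2[where m = "- p (- x)"]) auto
    have lower: "u x \<le> q x" if "q \<in> C" "x \<in> W" for q x
      unfolding u_def using that bdd by (auto intro: cINF_lower)
    have greatest: "c \<le> u x" if "\<And>q. q \<in> C \<Longrightarrow> c \<le> q x" "x \<in> W" for c x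
      unfolding u_def using that False by (auto intro: cINF_greatest)
    have "sublinear_on W u"
      unfolding sublinear_on_def
    proof (intro conjI ballI allI impI)
      fix x z assume xz: "x \<in> W" "z \<in> W"
      have *: "u (x + z) \<le> q x + r z" if qr: "q \<in> C" "r \<in> C" for q r
      proof -
        \<comment> \<open>Subadditivity of the infimum uses that \<open>C\<close> is a chain: the
          smaller of \<open>q\<close> and \<open>r\<close> serves for both arguments.\<close>
        obtain s where s: "s \<in> C" "s x \<le> q x" "s z \<le> r z"
          using chain[OF qr] qr by (auto simp: le_def)
        have "u (x + z) \<le> s (x + z)" by (intro lower s subspace_add[OF W] xz)
        also have "\<dots> \<le> s x + s z" using s CZ xz by (auto simp: Z_def sublinear_on_def)
        finally show ?thesis using s by linarith
      qed
      have "u (x + z) - r z \<le> u x" if "r \<in> C" for r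
        using *[OF _ that] xz by (intro greatest) (auto simp: algebra_simps)
      then have "u (x + z) - u x \<le> u z"
        using xz by (intro greatest) (auto simp: algebra_simps)
      then show "u (x + z) \<le> u x + u z" by simp
    next
      fix x and c :: real assume x: "x \<in> W" and c: "c > 0"
      have "u (c *\<^sub>R x) / c \<le> u x"
      proof (intro greatest x)
        fix q assume q: "q \<in> C"
        have "u (c *\<^sub>R x) \<le> q (c *\<^sub>R x)" by (intro lower q subspace_scale[OF W] x)
        also have "\<dots> \<le> c * q x" using q CZ x c by (auto simp: Z_def sublinear_on_def)
        finally show "u (c *\<^sub>R x) / c \<le> q x" using c by (simp add: field_simps)
      qed
      then show "u (c *\<^sub>R x) \<le> c * u x" using c by (simp add: field_simps)
    qed
    moreover have "u x \<le> p x" if x: "x \<in> W" for x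
    proof -
      obtain q where "q \<in> C" using False by auto
      then show ?thesis using lower[of q x] CZ x by (force simp: Z_def)
    qed
    ultimately have "u \<in> Z" by (simp add: Z_def u_def)
    moreover have "le q u" if "q \<in> C" for q
      using lower[OF that] that CZ by (auto simp: le_def Z_def u_def)
    ultimately show ?thesis by blast
  qed
  ultimately obtain q where q: "q \<in> Z" and min: "\<And>r. r \<in> Z \<Longrightarrow> le q r \<Longrightarrow> r = q"
    using predicate_Zorn[of Z le] by blast
  show thesis
  proof (rule that)
    show "sublinear_on W q" "\<And>x. x \<in> W \<Longrightarrow> q x \<le> p x" using q by (auto simp: Z_def)
    fix r x assume r: "sublinear_on W r" "\<And>x. x \<in> W \<Longrightarrow> r x \<le> q x" and x: "x \<in> W"
    let ?r = "\<lambda>x. if x \<in> W then r x else 0"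
    have "?r \<in> Z" using restrict[OF r(1)] r(2) q by (fastforce simp: Z_def)
    moreover have "le q ?r" using r(2) q by (auto simp: le_def Z_def)
    ultimately have "?r = q" by (rule min)
    from fun_cong[OF this, of x] show "r x = q x" using x by simp
  qed
qed

definition linear_on_set :: "'v::real_vector set \<Rightarrow> ('v \<Rightarrow> real) \<Rightarrow> bool" where
  "linear_on_set W f \<longleftrightarrow>
     (\<forall>x\<in>W. \<forall>y\<in>W. f (x + y) = f x + f y) \<and> (\<forall>c. \<forall>x\<in>W. f (c *\<^sub>R x) = c * f x)"

text \<open>Reducing \<open>p\<close> at \<open>x0\<close> first makes every functional below the
  result take a value of at most \<open>- p x0\<close> at \<open>- x0\<close>. A minimal one is odd,
  so its value at \<open>x0\<close> is at least \<open>p x0\<close>.\<close>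

theorem hahn_banach_sublinear:
  assumes p: "sublinear_on W p" and W: "subspace W" and x0: "x0 \<in> W"
  obtains f where "linear_on_set W f" "\<And>x. x \<in> W \<Longrightarrow> f x \<le> p x" "f x0 = p x0"
proof -
  obtain p' where p': "sublinear_on W p'" "\<And>x. x \<in> W \<Longrightarrow> p' x \<le> p x" "p' (- x0) \<le> - p x0"
    using sublinear_on_reduce[OF p W x0] by metis
  obtain f where f: "sublinear_on W f" and fp': "\<And>x. x \<in> W \<Longrightarrow> f x \<le> p' x"
    and min: "\<And>r x. \<lbrakk>sublinear_on W r; \<And>x. x \<in> W \<Longrightarrow> r x \<le> f x; x \<in> W\<rbrakk> \<Longrightarrow> r x = f x"
    using minimal_sublinear_on[OF p'(1) W] by metis
  have odd: "f (- y) = - f y" if y: "y \<in> W" for y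
  proof -
    obtain r where r: "sublinear_on W r" "\<And>x. x \<in> W \<Longrightarrow> r x \<le> f x" "r (- y) \<le> - f y"
      using sublinear_on_reduce[OF f W y] by metis
    have "f (- y) \<le> - f y"
      using min[OF r(1,2) subspace_neg[OF W y]] r(3) by simp
    moreover have "- f y \<le> f (- y)"
      using sublinear_on_minus[OF f W subspace_neg[OF W y]] by simp
    ultimately show ?thesis by simp
  qed
  have add: "f (x + y) = f x + f y" if "x \<in> W" "y \<in> W" for x y
  proof -
    have "f (- x + - y) \<le> f (- x) + f (- y)"
      by (intro sublinear_onD(1)[OF f] subspace_neg[OF W] that)
    moreover have "f (- x + - y) = - f (x + y)"
      using odd[OF subspace_add[OF W that]] by simp
    ultimately show ?thesis using odd that sublinear_onD(1)[OF f that] by simp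
  qed
  have scale: "f (c *\<^sub>R x) = c * f x" if x: "x \<in> W" for c x
  proof (cases "c \<ge> 0")
    case True
    then show ?thesis by (rule sublinear_on_scaleR[OF f W x])
  next
    case False
    then have "f ((- c) *\<^sub>R x) = (- c) * f x" by (intro sublinear_on_scaleR[OF f W x]) auto
    then show ?thesis using odd[OF subspace_scale[OF W x, of c]] by simp
  qed
  show thesis
  proof (rule that)
    show "linear_on_set W f" using add scale by (simp add: linear_on_set_def)
    show fp: "f x \<le> p x" if "x \<in> W" for x using fp'[OF that] p'(2)[OF that] by simp
    have "f (- x0) \<le> - p x0" using fp'[OF subspace_neg[OF W x0]] p'(3) by simp
    then show "f x0 = p x0" using odd[OF x0] fp[OF x0] by simp
  qed
qed

section \<open>Minkowski gauges of absorbing convex sets\<close>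

definition gauge_of :: "'v::real_vector set \<Rightarrow> 'v \<Rightarrow> real" where
  "gauge_of K x = Inf {t. t > 0 \<and> (\<exists>k\<in>K. x = t *\<^sub>R k)}"

lemma gauge_of_le:
  assumes "t > 0" "k \<in> K"
  shows "gauge_of K (t *\<^sub>R k) \<le> t"
  unfolding gauge_of_def using assms by (intro cInf_lower) (auto intro!: bdd_belowI[of _ 0])

text \<open>Absorption of \<open>x\<close> by \<open>K\<close> is assumed because a lower bound for
  an infimum says something only if the set of admissible factors is nonempty.\<close>

lemma gauge_of_greatest:
  assumes "t > 0" "t *\<^sub>R x \<in> K" "\<And>s k. s > 0 \<Longrightarrow> k \<in> K \<Longrightarrow> x = s *\<^sub>R k \<Longrightarrow> c \<le> s"
  shows "c \<le> gauge_of K x"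
  unfolding gauge_of_def
proof (rule cInf_greatest)
  have "x = inverse t *\<^sub>R (t *\<^sub>R x)" using assms(1) by simp
  then show "{t. t > 0 \<and> (\<exists>k\<in>K. x = t *\<^sub>R k)} \<noteq> {}"
    using assms(1,2) positive_imp_inverse_positive by blast
qed (use assms in auto)

lemma sublinear_on_gauge_of:
  assumes W: "subspace W" and K: "convex K"
    and absorb: "\<And>x. x \<in> W \<Longrightarrow> \<exists>t>0. t *\<^sub>R x \<in> K"
  shows "sublinear_on W (gauge_of K)"
  unfolding sublinear_on_def
proof (intro conjI ballI allI impI)
  have ge: "c \<le> gauge_of K x"
    if "x \<in> W" "\<And>s k. s > 0 \<Longrightarrow> k \<in> K \<Longrightarrow> x = s *\<^sub>R k \<Longrightarrow> c \<le> s" for x c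
    using absorb[OF that(1)] gauge_of_greatest[of _ x K c] that(2) by blast
  {
    fix x y assume xy: "x \<in> W" "y \<in> W"
    have *: "gauge_of K (x + y) \<le> s + t"
      if "s > 0" "k \<in> K" "x = s *\<^sub>R k" "t > 0" "l \<in> K" "y = t *\<^sub>R l" for s k t l
    proof -
      have "(s / (s + t)) *\<^sub>R k + (t / (s + t)) *\<^sub>R l \<in> K"
        using that by (intro convexD[OF K]) (auto simp: add_divide_distrib[symmetric])
      from gauge_of_le[OF _ this, of "s + t"] show ?thesis
        using that by (simp add: scaleR_add_right)
    qed
    have "gauge_of K (x + y) - t \<le> gauge_of K x" if "t > 0" "l \<in> K" "y = t *\<^sub>R l" for t l
      using *[OF _ _ _ that] xy by (intro ge) (auto simp: algebra_simps)
    then have "gauge_of K (x + y) - gauge_of K x \<le> gauge_of K y"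
      using xy by (intro ge) (auto simp: algebra_simps)
    then show "gauge_of K (x + y) \<le> gauge_of K x + gauge_of K y" by simp
  next
    fix x and c :: real assume x: "x \<in> W" and c: "c > 0"
    have "gauge_of K (c *\<^sub>R x) / c \<le> gauge_of K x"
    proof (intro ge x)
      fix s k assume sk: "s > 0" "k \<in> K" "x = s *\<^sub>R k"
      have "gauge_of K ((c * s) *\<^sub>R k) \<le> c * s" using sk c by (intro gauge_of_le) auto
      then show "gauge_of K (c *\<^sub>R x) / c \<le> s" using sk c by (simp add: field_simps)
    qed
    then show "gauge_of K (c *\<^sub>R x) \<le> c * gauge_of K x" using c by (simp add: field_simps)
  }
qed

section \<open>Neighbourhoods of zero, continuity of functionals and strict separation\<close>

lemma translation_continuous_map:
  assumes "locally_convex_topology W T" "x \<in> W"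
  shows "continuous_map T T ((+) x)"
proof -
  have top: "topspace T = W" and add: "continuous_map (prod_topology T T) T (\<lambda>(x, y). x + y)"
    using assms by (auto simp: locally_convex_topology_def)
  have "continuous_map T (prod_topology T T) (\<lambda>y. (x, y))"
    using assms(2) top by (auto simp: continuous_map_pairwise o_def)
  from continuous_map_compose[OF this add] show ?thesis by (simp add: o_def)
qed

lemma nhds_0_absorbing:
  assumes lc: "locally_convex_topology W T" and V: "openin T V" "0 \<in> V" and x: "x \<in> W"
  obtains t where "t > 0" "t *\<^sub>R x \<in> V"
proof -
  have top: "topspace T = W" and sc: "continuous_map (prod_topology euclideanreal T) T (\<lambda>(c, x). c *\<^sub>R x)"
    using lc by (auto simp: locally_convex_topology_def)
  have "continuous_map euclideanreal (prod_topology euclideanreal T) (\<lambda>c. (c, x))"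
    using x top by (auto simp: continuous_map_pairwise o_def)
  from continuous_map_compose[OF this sc]
  have "continuous_map euclideanreal T (\<lambda>c. c *\<^sub>R x)" by (simp add: o_def)
  from openin_continuous_map_preimage[OF this V(1)]
  have "open {c. c *\<^sub>R x \<in> V}" by (simp add: vimage_def)
  then obtain e where e: "e > 0" "ball 0 e \<subseteq> {c. c *\<^sub>R x \<in> V}"
    using V(2) openE[of "{c. c *\<^sub>R x \<in> V}" 0] by auto
  have "e / 2 \<in> ball 0 e" using e by (simp add: dist_norm)
  then have "(e / 2) *\<^sub>R x \<in> V" using e(2) by blast
  then show thesis using that[of "e / 2"] e(1) by simp
qed

lemma continuous_functional_if_bounded_nhd:
  assumes lc: "locally_convex_topology W T" and f: "linear_on_set W f"
    and V: "openin T V" "0 \<in> V" and bound: "\<And>v. v \<in> V \<Longrightarrow> f v \<le> 1"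
  shows "continuous_functional W T f"
proof -
  have W: "subspace W" and top: "topspace T = W"
    and sc: "continuous_map (prod_topology euclideanreal T) T (\<lambda>(c, x). c *\<^sub>R x)"
    using lc by (auto simp: locally_convex_topology_def)
  have fadd: "f (x + y) = f x + f y" if "x \<in> W" "y \<in> W" for x y
    using f that by (auto simp: linear_on_set_def)
  have fsc: "f (c *\<^sub>R x) = c * f x" if "x \<in> W" for c x
    using f that by (auto simp: linear_on_set_def)
  have scale: "continuous_map T T (\<lambda>x. c *\<^sub>R x)" for c
  proof -
    have "continuous_map T (prod_topology euclideanreal T) (\<lambda>x. (c, x))"
      by (auto simp: continuous_map_pairwise o_def)
    from continuous_map_compose[OF this sc] show ?thesis by (simp add: o_def)
  qed
  have "\<exists>U. openin T U \<and> x \<in> U \<and> (\<forall>y\<in>U. f y \<in> ball (f x) e)" if x: "x \<in> W" and e: "e > 0" for x e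
  proof -
    \<comment> \<open>\<open>V\<close> need not be symmetric, so both signs are imposed. The factor
      \<open>2/e\<close> turns the bound 1 on \<open>V\<close> into a distance of at most
      \<open>e/2\<close> between \<open>f x\<close> and \<open>f y\<close>.\<close>
    define U where "U = {y \<in> topspace T. (2/e) *\<^sub>R (- x + y) \<in> V} \<inter> {y \<in> topspace T. (- (2/e)) *\<^sub>R (- x + y) \<in> V}"
    have "openin T {y \<in> topspace T. c *\<^sub>R (- x + y) \<in> V}" for c
    proof (rule openin_continuous_map_preimage[OF _ V(1)])
      show "continuous_map T T (\<lambda>y. c *\<^sub>R (- x + y))"
        using continuous_map_compose[OF translation_continuous_map[OF lc subspace_neg[OF W x]] scale[of c]]
        by (simp add: o_def)
    qed
    then have "openin T U" unfolding U_def by blast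
    moreover have "x \<in> U" using x top V(2) by (simp add: U_def)
    moreover have "f y \<in> ball (f x) e" if "y \<in> U" for y
    proof -
      have y: "y \<in> W" using that top by (simp add: U_def)
      have d: "- x + y \<in> W" by (intro subspace_add[OF W] subspace_neg[OF W] x y)
      have fd: "f (- x + y) = f y - f x"
        using fadd[OF x d] by simp
      have "f ((2/e) *\<^sub>R (- x + y)) \<le> 1" "f ((- (2/e)) *\<^sub>R (- x + y)) \<le> 1"
        using that by (auto simp: U_def intro!: bound)
      then have "(2/e) * (f y - f x) \<le> 1" "(- (2/e)) * (f y - f x) \<le> 1"
        unfolding fsc[OF d] fd by simp_all
      then have "f y - f x \<le> e/2" "- (f y - f x) \<le> e/2" using e by (simp_all add: field_simps)
      then show ?thesis using e by (simp add: dist_real_def)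
    qed
    ultimately show ?thesis by blast
  qed
  then have "continuous_map T euclideanreal f"
    using Met_TC.continuous_map_to_metric[of T f]
    by (simp only: mtopology_is_euclidean mball_eq_ball top) blast
  then show ?thesis using fadd fsc by (auto simp: continuous_functional_def)
qed

text \<open>The convex set \<open>K = V + (c0 - C)\<close> contains a neighbourhood of 0 and misses
  \<open>c0 - x\<close>, so Hahn-Banach for its gauge gives \<open>f \<le> 1\<close> on
  \<open>K\<close> and \<open>f (c0 - x) \<ge> 1\<close>. This alone separates weakly; the gap
  \<open>t\<close> arises because \<open>V\<close> still contains
  \<open>t *\<^sub>R (c0 - x)\<close>. The functional returned is \<open>- f\<close>.\<close>

theorem strict_separation_point:
  assumes lc: "locally_convex_topology W T" and C: "convex C" "C \<subseteq> W" "C \<noteq> {}"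
    and x: "x \<in> W" "x \<notin> T closure_of C"
  obtains f t where "continuous_functional W T f" "t > 0" "\<And>c. c \<in> C \<Longrightarrow> f c + t \<le> f x"
proof -
  have W: "subspace W" and top: "topspace T = W"
    and loc: "\<And>U. openin T U \<Longrightarrow> 0 \<in> U \<Longrightarrow> \<exists>V. openin T V \<and> convex V \<and> 0 \<in> V \<and> V \<subseteq> U"
    using lc by (auto simp: locally_convex_topology_def)
  obtain U where U: "openin T U" "x \<in> U" "U \<inter> C = {}"
    using x top by (auto simp: in_closure_of)
  have "openin T {y \<in> topspace T. x + y \<in> U}"
    by (rule openin_continuous_map_preimage[OF translation_continuous_map[OF lc x(1)] U(1)])
  moreover have "0 \<in> {y \<in> topspace T. x + y \<in> U}" using U top subspace_0[OF W] by simp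
  ultimately obtain V where V: "openin T V" "convex V" "0 \<in> V" and VU: "\<And>v. v \<in> V \<Longrightarrow> x + v \<in> U"
    using loc[of "{y \<in> topspace T. x + y \<in> U}"] by blast
  obtain c0 where c0: "c0 \<in> C" using C by auto
  define K where "K = {v + (c0 - c) |v c. v \<in> V \<and> c \<in> C}"
  have "K = (\<Union>v\<in>V. \<Union>d\<in>(\<lambda>c. c0 - c) ` C. {v + d})" by (auto simp: K_def)
  moreover have "convex ((\<lambda>c. c0 - c) ` C)"
    using convex_translation[OF convex_negations[OF C(1)], of c0] by (simp add: image_image)
  ultimately have convK: "convex K" by (simp only: convex_sums[OF V(2)])
  have VK: "v \<in> K" if "v \<in> V" for v using that c0 by (force simp: K_def)
  have x0: "c0 - x \<notin> K" 
  proof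
    assume "c0 - x \<in> K"
    then obtain v c where vc: "v \<in> V" "c \<in> C" "c0 - x = v + (c0 - c)" by (auto simp: K_def)
    then have "x + v = c" by (simp add: algebra_simps)
    then show False using VU[OF vc(1)] vc(2) U(3) by auto
  qed
  have x0W: "c0 - x \<in> W" using C c0 x by (intro subspace_diff[OF W]) auto
  let ?p = "gauge_of K"
  have p: "sublinear_on W ?p"
  proof (rule sublinear_on_gauge_of[OF W convK])
    show "\<exists>t>0. t *\<^sub>R y \<in> K" if y: "y \<in> W" for y
      using nhds_0_absorbing[OF lc V(1,3) y] VK by blast
  qed
  obtain t where t: "t > 0" "t *\<^sub>R (c0 - x) \<in> V"
    using nhds_0_absorbing[OF lc V(1,3) x0W] by metis
  obtain f where f: "linear_on_set W f" "\<And>y. y \<in> W \<Longrightarrow> f y \<le> ?p y" "f (c0 - x) = ?p (c0 - x)"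
    using hahn_banach_sublinear[OF p W x0W] by metis
  have fK: "f y \<le> 1" if "y \<in> K" "y \<in> W" for y
    using f(2)[OF that(2)] gauge_of_le[of 1 y K] that(1) by simp
  have "1 \<le> ?p (c0 - x)"
  proof (rule gauge_of_greatest[OF t(1) VK[OF t(2)]])
    fix s k assume s: "s > 0" "k \<in> K" "c0 - x = s *\<^sub>R k"
    show "1 \<le> s"
    proof (rule ccontr)
      assume "\<not> 1 \<le> s"
      then have "s *\<^sub>R k + (1 - s) *\<^sub>R 0 \<in> K"
        using s VK[OF V(3)] by (intro convexD[OF convK]) auto
      then show False using s x0 by simp
    qed
  qed
  then have f1: "1 \<le> f (c0 - x)" using f(3) by simp
  have fdiff: "f (a - b) = f a - f b" if "a \<in> W" "b \<in> W" for a b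
  proof -
    have "f ((a - b) + b) = f (a - b) + f b"
      using f(1) that subspace_diff[OF W that] unfolding linear_on_set_def by blast
    then show ?thesis by simp
  qed
  have VW: "V \<subseteq> W" using openin_subset[OF V(1)] top by simp
  have cf: "continuous_functional W T f"
    using continuous_functional_if_bounded_nhd[OF lc f(1) V(1,3)] fK VK VW by blast
  have sep: "f x + t \<le> f c" if c: "c \<in> C" for c
  proof -
    have cW: "c \<in> W" "c0 \<in> W" using c c0 C by auto
    have W': "t *\<^sub>R (c0 - x) \<in> W" "c0 - c \<in> W"
      by (intro subspace_scale[OF W] subspace_diff[OF W] x0W cW)+
    have "t *\<^sub>R (c0 - x) + (c0 - c) \<in> K" using t c by (auto simp: K_def)
    then have "f (t *\<^sub>R (c0 - x) + (c0 - c)) \<le> 1"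
      by (rule fK) (intro subspace_add[OF W] W')
    then have "t * f (c0 - x) + (f c0 - f c) \<le> 1"
      using f(1) W' x0W fdiff[OF cW(2,1)] by (simp add: linear_on_set_def)
    moreover have "f (c0 - x) = f c0 - f x" by (rule fdiff[OF cW(2) x(1)])
    moreover have "t \<le> t * f (c0 - x)" using f1 t by simp
    ultimately show ?thesis using f1 by linarith
  qed
  have "continuous_functional W T (\<lambda>y. - f y)"
    using cf by (auto simp: continuous_functional_def intro: continuous_map_minus)
  then show thesis by (rule that[OF _ t(1)]) (use sep in fastforce)
qed

subsection \<open>Finite supports and polyhedra\<close>

text \<open>With total weight \<open>?M\<close> and weighted sum \<open>?s\<close>, the terms
  \<open>w x * (?s - ?M * a x)\<close> add up to 0. If the claim failed, they would be nonnegative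
  with positive second factor, so \<open>w\<close> would vanish on \<open>C\<close>, and then
  \<open>?s = ?M = 0\<close> contradicts the strict inequality at any point of
  \<open>C\<close>.\<close>

lemma exists_ge_weighted_mean:
  fixes w a :: "'a \<Rightarrow> real"
  assumes C: "C \<noteq> {}" and w: "\<And>x. x \<in> C \<Longrightarrow> 0 \<le> w x" "w summable_on C"
    and wa: "(\<lambda>x. w x * a x) summable_on C"
  shows "\<exists>x\<in>C. (\<Sum>\<^sub>\<infinity>x\<in>C. w x * a x) \<le> infsum w C * a x"
proof (rule ccontr)
  let ?s = "\<Sum>\<^sub>\<infinity>x\<in>C. w x * a x" and ?M = "infsum w C"
  assume "\<not> ?thesis"
  then have less: "?M * a x < ?s" if "x \<in> C" for x using that by force
  have "((\<lambda>x. ?s * w x + - ?M * (w x * a x)) has_sum (?s * ?M + - ?M * ?s)) C"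
    using w wa by (intro has_sum_add has_sum_cmult_right has_sum_infsum)
  then have *: "((\<lambda>x. w x * (?s - ?M * a x)) has_sum 0) C" by (simp add: algebra_simps)
  have "w x * (?s - ?M * a x) = 0" if "x \<in> C" for x
    by (rule nonneg_has_sum_le_0D[OF *]) (use less w that in \<open>auto intro!: mult_nonneg_nonneg simp: less_imp_le\<close>)
  then have "w x = 0" if "x \<in> C" for x using less that by force
  then have "?s = 0" "?M = 0" by (auto intro!: infsum_0)
  then show False using less C by auto
qed

lemma infsum_finite_partition:
  fixes f :: "'a \<Rightarrow> real"
  assumes "finite (\<tau> ` S)" "f summable_on S"
  shows "infsum f S = (\<Sum>c\<in>\<tau> ` S. infsum f {x \<in> S. \<tau> x = c})"
proof -
  have "(\<Sum>c\<in>\<tau> ` S. infsum f {x \<in> S. \<tau> x = c}) = infsum f (\<Union>c\<in>\<tau> ` S. {x \<in> S. \<tau> x = c})"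
    using assms by (intro sum_infsum) (auto intro: summable_on_subset_banach)
  also have "(\<Union>c\<in>\<tau> ` S. {x \<in> S. \<tau> x = c}) = S" by auto
  finally show ?thesis by simp
qed

text \<open>All the mass of a type class is moved to one point where \<open>a\<close> is at least average.\<close>

lemma finite_support_reduction:
  fixes w a :: "'a \<Rightarrow> real"
  assumes w: "\<And>x. x \<in> R \<Longrightarrow> 0 \<le> w x" "w summable_on R"
    and wa: "(\<lambda>x. w x * a x) summable_on R" and fin: "finite (\<tau> ` R)"
  obtains F u where "finite F" "F \<subseteq> R" "\<forall>x. x \<notin> F \<longrightarrow> u x = 0" "\<forall>x. 0 \<le> u x"
    "\<forall>S\<subseteq>R. (\<forall>x\<in>S. \<forall>y\<in>R. \<tau> y = \<tau> x \<longrightarrow> y \<in> S) \<longrightarrow> sum u (F \<inter> S) = infsum w S"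
    "(\<Sum>\<^sub>\<infinity>x\<in>R. w x * a x) \<le> (\<Sum>x\<in>F. u x * a x)"
proof -
  define cls where "cls c = {x \<in> R. \<tau> x = c}" for c
  define mass where "mass c = infsum w (cls c)" for c
  have cls_sub: "cls c \<subseteq> R" for c by (auto simp: cls_def)
  have "\<exists>x\<in>cls c. (\<Sum>\<^sub>\<infinity>x\<in>cls c. w x * a x) \<le> mass c * a x" if "c \<in> \<tau> ` R" for c
    unfolding mass_def using that w(1)
    by (intro exists_ge_weighted_mean summable_on_subset_banach[OF w(2) cls_sub]
        summable_on_subset_banach[OF wa cls_sub]) (auto simp: cls_def)
  then obtain rep where rep: "\<And>c. c \<in> \<tau> ` R \<Longrightarrow> rep c \<in> cls c"
    "\<And>c. c \<in> \<tau> ` R \<Longrightarrow> (\<Sum>\<^sub>\<infinity>x\<in>cls c. w x * a x) \<le> mass c * a (rep c)"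
    by metis
  have rep': "rep c \<in> R" "\<tau> (rep c) = c" if "c \<in> \<tau> ` R" for c
    using rep(1)[OF that] by (auto simp: cls_def)
  define F where "F = rep ` \<tau> ` R"
  define u where "u x = (if x \<in> F then mass (\<tau> x) else 0)" for x
  have inj: "inj_on rep (\<tau> ` R)" by (metis inj_onI rep'(2))
  have mass0: "0 \<le> mass c" for c
    unfolding mass_def using w(1) by (intro infsum_nonneg) (auto simp: cls_def)
  have u_rep: "u (rep c) = mass c" if "c \<in> \<tau> ` R" for c
    using that rep' by (auto simp: u_def F_def)
  show thesis
  proof (rule that[of F u])
    show "finite F" using fin by (simp add: F_def)
    show "F \<subseteq> R" using rep' by (auto simp: F_def)
    show "\<forall>x. x \<notin> F \<longrightarrow> u x = 0" "\<forall>x. 0 \<le> u x" using mass0 by (simp_all add: u_def)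
    have "sum u (F \<inter> S) = infsum w S"
      if S: "S \<subseteq> R" "\<forall>x\<in>S. \<forall>y\<in>R. \<tau> y = \<tau> x \<longrightarrow> y \<in> S" for S
    proof -
      \<comment> \<open>\<open>S\<close> is a union of type classes, so it contains the
        representative of every class that it meets.\<close>
      have eq: "F \<inter> S = rep ` \<tau> ` S"
      proof
        show "F \<inter> S \<subseteq> rep ` \<tau> ` S"
        proof
          fix x assume "x \<in> F \<inter> S"
          then obtain c where "c \<in> \<tau> ` R" "x = rep c" "x \<in> S" by (auto simp: F_def)
          then show "x \<in> rep ` \<tau> ` S" using rep'(2)[of c] by (metis imageI)
        qed
        have "rep (\<tau> x) \<in> F \<inter> S" if "x \<in> S" for x
        proof -
          have c: "\<tau> x \<in> \<tau> ` R" using that S(1) by blast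
          then have "rep (\<tau> x) \<in> S" using S(2) that rep' by blast
          then show ?thesis using c by (simp add: F_def)
        qed
        then show "rep ` \<tau> ` S \<subseteq> F \<inter> S" by blast
      qed
      have sub: "\<tau> ` S \<subseteq> \<tau> ` R" using S by auto
      have "sum u (F \<inter> S) = (\<Sum>c\<in>\<tau> ` S. u (rep c))"
        unfolding eq by (subst sum.reindex[OF inj_on_subset[OF inj sub]]) simp
      also have "\<dots> = (\<Sum>c\<in>\<tau> ` S. infsum w {x \<in> S. \<tau> x = c})"
      proof (rule sum.cong[OF refl])
        fix c assume c: "c \<in> \<tau> ` S"
        then have "cls c = {x \<in> S. \<tau> x = c}" using S by (auto simp: cls_def)
        then show "u (rep c) = infsum w {x \<in> S. \<tau> x = c}"
          using u_rep c sub by (auto simp: mass_def)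
      qed
      also have "\<dots> = infsum w S"
        by (rule infsum_finite_partition[symmetric, OF finite_subset[OF sub fin]
            summable_on_subset_banach[OF w(2) S(1)]])
      finally show ?thesis .
    qed
    then show "\<forall>S\<subseteq>R. (\<forall>x\<in>S. \<forall>y\<in>R. \<tau> y = \<tau> x \<longrightarrow> y \<in> S) \<longrightarrow> sum u (F \<inter> S) = infsum w S"
      by blast
    have "(\<Sum>\<^sub>\<infinity>x\<in>R. w x * a x) = (\<Sum>c\<in>\<tau> ` R. \<Sum>\<^sub>\<infinity>x\<in>cls c. w x * a x)"
      unfolding cls_def by (rule infsum_finite_partition[OF fin wa])
    also have "\<dots> \<le> (\<Sum>c\<in>\<tau> ` R. u (rep c) * a (rep c))"
      by (rule sum_mono) (simp add: rep(2) u_rep)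
    also have "\<dots> = (\<Sum>x\<in>F. u x * a x)"
      unfolding F_def by (subst sum.reindex[OF inj]) simp
    finally show "(\<Sum>\<^sub>\<infinity>x\<in>R. w x * a x) \<le> (\<Sum>x\<in>F. u x * a x)" .
  qed
qed

text \<open>
  From a point that is not extreme one moves along a segment, in the direction in which \<open>\<phi>\<close>
  does not decrease, until another constraint becomes tight; the tight ones stay tight.
\<close>

lemma polyhedron_extreme_point_ge:
  fixes l :: "'i \<Rightarrow> 'v::real_vector \<Rightarrow> real" and \<phi> :: "'v \<Rightarrow> real"
  assumes A: "finite A"
    and E: "\<And>x y z t. \<lbrakk>x \<in> E; y \<in> E; z \<in> E\<rbrakk> \<Longrightarrow> x + t *\<^sub>R (z - y) \<in> E"
    and l: "\<And>i x y z t. \<lbrakk>i \<in> A; x \<in> E; y \<in> E; z \<in> E\<rbrakk> \<Longrightarrow> l i (x + t *\<^sub>R (z - y)) = l i x + t * (l i z - l i y)"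
    and \<phi>: "\<And>x y z t. \<lbrakk>x \<in> E; y \<in> E; z \<in> E\<rbrakk> \<Longrightarrow> \<phi> (x + t *\<^sub>R (z - y)) = \<phi> x + t * (\<phi> z - \<phi> y)"
    and bounded: "\<And>x y. \<lbrakk>x \<in> E; y \<in> E; x \<noteq> y\<rbrakk> \<Longrightarrow> \<exists>i\<in>A. l i x < l i y"
    and x: "x \<in> E" "\<And>i. i \<in> A \<Longrightarrow> 0 \<le> l i x"
  shows "\<exists>e. e extreme_point_of {x \<in> E. \<forall>i\<in>A. 0 \<le> l i x} \<and> \<phi> x \<le> \<phi> e"
  using x
proof (induction "card {i \<in> A. 0 < l i x}" arbitrary: x rule: less_induct)
  case less
  let ?P = "{x \<in> E. \<forall>i\<in>A. 0 \<le> l i x}"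
  show ?case
  proof (cases "x extreme_point_of ?P")
    case True
    then show ?thesis by blast
  next
    case False
    have "x \<in> ?P" using less.prems by auto
    with False obtain a' b' where ab': "a' \<in> ?P" "b' \<in> ?P" "x \<in> open_segment a' b'"
      by (auto simp: extreme_point_of_def)
    \<comment> \<open>The ends are ordered so that moving in the direction \<open>b - a\<close> does
      not lower \<open>\<phi>\<close>.\<close>
    obtain a b where a: "a \<in> ?P" and b: "b \<in> ?P" and seg: "x \<in> open_segment a b" and \<phi>ab: "\<phi> a \<le> \<phi> b"
    proof (cases "\<phi> a' \<le> \<phi> b'")
      case True
      then show ?thesis using that ab' by blast
    next
      case False
      then show ?thesis using that[of b' a'] ab' by (simp add: open_segment_commute)
    qed
    obtain s where s: "0 < s" "s < 1" and ab: "a \<noteq> b" and xs: "x = (1 - s) *\<^sub>R a + s *\<^sub>R b"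
      using seg by (auto simp: in_segment)
    have aE: "a \<in> E" "b \<in> E" and la: "\<And>i. i \<in> A \<Longrightarrow> 0 \<le> l i a" and lb: "\<And>i. i \<in> A \<Longrightarrow> 0 \<le> l i b"
      using a b by auto
    have xs': "x = a + s *\<^sub>R (b - a)" using xs by (simp add: algebra_simps)
    have lx: "l i x = (1 - s) * l i a + s * l i b" if "i \<in> A" for i
      using l[OF that aE(1) aE(1) aE(2), of s, folded xs'] by (simp add: algebra_simps)
    \<comment> \<open>Only the constraints in \<open>J\<close> decrease in the direction
      \<open>b - a\<close>, and \<open>bounded\<close> provides one. \<open>r i\<close> is the step
      length at which \<open>i\<close> becomes tight, so the smallest of these keeps the new point
      feasible.\<close>
    define J where "J = {i \<in> A. l i b < l i a}"
    have J: "finite J" "J \<noteq> {}" using A bounded[OF aE(2,1)] ab by (auto simp: J_def)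
    define r where "r i = l i x / (l i a - l i b)" for i
    define t where "t = Min (r ` J)"
    obtain i0 where i0: "i0 \<in> J" "t = r i0"
      using Min_in[of "r ` J"] J unfolding t_def by blast
    have t_le: "t \<le> r i" if "i \<in> J" for i using J that by (simp add: t_def)
    have t0: "0 \<le> t" using i0 less.prems by (auto simp: r_def J_def)
    define y where "y = x + t *\<^sub>R (b - a)"
    have yE: "y \<in> E" unfolding y_def by (rule E[OF less.prems(1) aE])
    have ly: "l i y = l i x + t * (l i b - l i a)" if "i \<in> A" for i
      unfolding y_def by (rule l[OF that less.prems(1) aE])
    have ly0: "0 \<le> l i y" if i: "i \<in> A" for i
    proof (cases "i \<in> J")
      case True
      then have "t * (l i a - l i b) \<le> l i x"
        using t_le[OF True] by (simp add: r_def J_def field_simps)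
      then show ?thesis using ly[OF i] by (simp add: algebra_simps)
    next
      case False
      then have "0 \<le> t * (l i b - l i a)" using t0 i by (simp add: J_def)
      then show ?thesis using ly[OF i] less.prems(2)[OF i] by simp
    qed
    \<comment> \<open>A value 0 at \<open>x\<close> is a sum of nonnegative values at
      \<open>a\<close> and \<open>b\<close> with positive weights, so the constraint is tight at
      both ends and hence along the whole line.\<close>
    have tight: "l i y = 0" if i: "i \<in> A" "l i x = 0" for i
    proof -
      have "(1 - s) * l i a = 0 \<and> s * l i b = 0"
        using lx[OF i(1)] i(2) la[OF i(1)] lb[OF i(1)] s
        by (subst add_nonneg_eq_0_iff[symmetric]) auto
      then show ?thesis using ly[OF i(1)] i(2) s by simp
    qed
    have i0A: "i0 \<in> A" "l i0 b < l i0 a" using i0 by (auto simp: J_def)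
    have "l i0 y = 0" using ly[OF i0A(1)] i0A(2) i0(2) by (simp add: r_def field_simps)
    \<comment> \<open>The constraint \<open>i0\<close> was slack at \<open>x\<close> and is tight at
      \<open>y\<close>, so the number of slack constraints drops strictly.\<close>
    moreover have "0 < l i0 x"
    proof -
      have "0 < (1 - s) * l i0 a" using i0A lb[OF i0A(1)] s by simp
      moreover have "0 \<le> s * l i0 b" using lb[OF i0A(1)] s by simp
      ultimately show ?thesis using lx[OF i0A(1)] by simp
    qed
    ultimately have "i0 \<in> {i \<in> A. 0 < l i x} - {i \<in> A. 0 < l i y}" using i0A by simp
    moreover have "{i \<in> A. 0 < l i y} \<subseteq> {i \<in> A. 0 < l i x}"
      using tight less.prems(2) by (force simp: less_le)
    ultimately have "card {i \<in> A. 0 < l i y} < card {i \<in> A. 0 < l i x}"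
      using A by (intro psubset_card_mono) auto
    from less.hyps[OF this yE ly0]
    obtain e where "e extreme_point_of ?P" "\<phi> y \<le> \<phi> e" by blast
    moreover have "\<phi> x \<le> \<phi> y"
      unfolding y_def \<phi>[OF less.prems(1) aE] using t0 \<phi>ab by simp
    ultimately show ?thesis by force
  qed
qed

lemma finite_meeting_indices:
  assumes "\<And>x. x \<in> ground I Om \<Longrightarrow> finite {k \<in> I. x \<in> Om k}" "finite F" "F \<subseteq> ground I Om"
  shows "finite {k \<in> I. Om k \<inter> F \<noteq> {}}"
proof -
  have "{k \<in> I. Om k \<inter> F \<noteq> {}} = (\<Union>x\<in>F. {k \<in> I. x \<in> Om k})" by auto
  then show ?thesis using assms by auto
qed

subsection \<open>Chains of representatives of the tail sets\<close>

text \<open>Together the conditions say that a set of index at most \<open>n\<close> contains no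
  representative, while one of index \<open>k > n\<close> contains \<open>g k\<close> and at most
  one earlier representative, and misses \<open>E\<close> if it contains an earlier one. The sum
  over \<open>Om k\<close> therefore fixes the value at \<open>g k\<close> from \<open>E\<close> or
  from one earlier value.\<close>

locale tail_chain =
  fixes I :: "nat set" and Om :: "nat \<Rightarrow> 'a set" and n :: nat and E :: "'a set" and g :: "nat \<Rightarrow> 'a"
  assumes mem: "\<lbrakk>k \<in> I; n < k\<rbrakk> \<Longrightarrow> g k \<in> Om k"
    and later: "\<lbrakk>k \<in> I; n < k; j \<in> I; j \<noteq> k; g k \<in> Om j\<rbrakk> \<Longrightarrow> k < j"
    and off_E: "\<lbrakk>k \<in> I; n < k; j \<in> I; j \<noteq> k; g k \<in> Om j\<rbrakk> \<Longrightarrow> Om j \<inter> E = {}"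
    and sparse: "\<lbrakk>k \<in> I; n < k; j \<in> I; j \<noteq> k; g k \<in> Om j; i \<in> I; n < i; i < k\<rbrakk> \<Longrightarrow> g i \<notin> Om j"
    and E_low: "E \<subseteq> (\<Union>k\<in>{k \<in> I. k \<le> n}. Om k)"
begin

definition ind :: "nat set" where "ind = {k \<in> I. n < k}"

text \<open>Kept as a set, although for \<open>k\<close> in \<open>I\<close> it has at most one
  element, so that sums over it also cover indices without a parent.\<close>

definition parents :: "nat \<Rightarrow> nat set" where "parents k = {i \<in> ind. i < k \<and> g i \<in> Om k}"

lemma g_in_ground: "k \<in> ind \<Longrightarrow> g k \<in> ground I Om"
  using mem by (auto simp: ind_def ground_def)

lemma g_notin_E: 
  assumes "k \<in> ind" shows "g k \<notin> E"
proof
  assume "g k \<in> E"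
  then obtain j where "j \<in> I" "j \<le> n" "g k \<in> Om j" using E_low by auto
  then show False using later[of k j] assms by (force simp: ind_def)
qed

lemma inj_on_g: "inj_on g ind"
proof (rule linorder_inj_onI')
  fix i j assume ij: "i \<in> ind" "j \<in> ind" "i < j"
  show "g i \<noteq> g j"
    using later[of j i] mem[of i] ij by (auto simp: ind_def)
qed

lemma g_in_Om_le: "\<lbrakk>i \<in> ind; k \<in> I; g i \<in> Om k\<rbrakk> \<Longrightarrow> i \<le> k"
  using later[of i k] by (cases "k = i") (auto simp: ind_def)

lemma parents_unique:
  assumes "k \<in> I" "i \<in> parents k" "j \<in> parents k"
  shows "i = j"
  using assms sparse[of i k j] sparse[of j k i]
  by (cases i j rule: linorder_cases) (auto simp: parents_def ind_def)

lemma parents_cases: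
  assumes "k \<in> I"
  obtains "parents k = {}" | i where "i \<in> ind" "i < k" "parents k = {i}" "Om k \<inter> E = {}"
proof (cases "parents k = {}")
  case False
  then obtain i where i: "i \<in> parents k" by auto
  moreover have "Om k \<inter> E = {}" using off_E[of i k] i assms by (auto simp: parents_def ind_def)
  moreover have "parents k = {i}" using parents_unique[OF assms i] i by blast
  ultimately show ?thesis using that(2)[of i] by (simp add: parents_def)
qed (rule that(1))

text \<open>Representatives with index above \<open>k\<close> do not lie in \<open>Om k\<close>, so
  a function carried by \<open>E\<close> and the representatives has only finitely many nonzero
  values there. The alternative 0 for \<open>k \<le> n\<close> reflects that low sets contain no
  representative.\<close>

lemma has_sum_Om:
  fixes f :: "'a \<Rightarrow> real"
  assumes E: "finite E" and k: "k \<in> I" and f: "\<And>x. x \<notin> E \<union> g ` ind \<Longrightarrow> f x = 0"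
  shows "(f has_sum (sum f (Om k \<inter> E) + (if n < k then f (g k) + (\<Sum>i\<in>parents k. f (g i)) else 0))) (Om k)"
proof -
  let ?B = "if n < k then insert k (parents k) else {}"
  have fin: "finite (parents k)" by (auto simp: parents_def)
  have sub: "?B \<subseteq> ind" using k by (auto simp: parents_def ind_def)
  have Om: "g i \<in> Om k" if "i \<in> ?B" for i using that k mem by (auto simp: parents_def split: if_splits)
  have "(f has_sum (sum f (Om k \<inter> E) + sum f (g ` ?B))) (Om k)"
  proof (rule has_sum_finite_neutralI)
    show "finite (Om k \<inter> E \<union> g ` ?B)" using E fin by auto
    show "Om k \<inter> E \<union> g ` ?B \<subseteq> Om k" using Om by blast
    have "g i \<in> g ` ?B" if "i \<in> ind" "g i \<in> Om k" for i
      using g_in_Om_le[OF that(1) k that(2)] that by (cases "i = k") (auto simp: parents_def ind_def)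
    then show "f x = 0" if "x \<in> Om k - (Om k \<inter> E \<union> g ` ?B)" for x
      using that by (intro f) blast
    have "(Om k \<inter> E) \<inter> g ` ?B = {}" using g_notin_E sub by blast
    then show "sum f (Om k \<inter> E) + sum f (g ` ?B) = sum f (Om k \<inter> E \<union> g ` ?B)"
      using E fin by (intro sum.union_disjoint[symmetric]) auto
  qed
  also have "sum f (g ` ?B) = (\<Sum>i\<in>?B. f (g i))"
    using inj_on_subset[OF inj_on_g sub] by (simp add: sum.reindex)
  also have "\<dots> = (if n < k then f (g k) + (\<Sum>i\<in>parents k. f (g i)) else 0)"
    using fin by (auto simp: parents_def)
  finally show ?thesis .
qed

text \<open>The only representatives in \<open>Om k\<close> can be \<open>g k\<close> and that of
  the parent of \<open>k\<close>, and an independent set \<open>B\<close> does not contain both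
  indices.\<close>

lemma indicator_subpermutation:
  assumes B: "B \<subseteq> ind" and indep: "\<And>k i. k \<in> B \<Longrightarrow> i \<in> B \<Longrightarrow> i \<notin> parents k"
  shows "(\<lambda>x. of_bool (x \<in> g ` B)) \<in> subpermutation I Om"
proof -
  have "(\<lambda>x. of_bool (x \<in> g ` B) :: real) summable_on Om k \<and> (\<Sum>\<^sub>\<infinity>x\<in>Om k. of_bool (x \<in> g ` B)) \<le> (1::real)"
    if k: "k \<in> I" for k
  proof -
    let ?X = "Om k \<inter> g ` B"
    have "i = j" if ij: "i \<in> B" "j \<in> B" "g i \<in> Om k" "g j \<in> Om k" for i j
    proof -
      have *: "i \<in> ind" "j \<in> ind" using ij B by auto
      have "i \<le> k" "j \<le> k" using g_in_Om_le[OF _ k] ij * by auto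
      moreover have "i \<in> parents k" if "i < k" using that ij * by (simp add: parents_def)
      moreover have "j \<in> parents k" if "j < k" using that ij * by (simp add: parents_def)
      ultimately show "i = j" using indep ij parents_unique[OF k] by (metis le_neq_implies_less)
    qed
    then obtain x where x: "?X \<subseteq> {x}"
      by (cases "?X = {}") blast+
    have h: "((\<lambda>x. of_bool (x \<in> g ` B)) has_sum real (card ?X)) (Om k)"
    proof (rule has_sum_finite_neutralI)
      show "finite ?X" using x finite_subset by blast
      show "real (card ?X) = (\<Sum>x\<in>?X. of_bool (x \<in> g ` B))" by simp
    qed auto
    moreover have "card ?X \<le> 1" using card_mono[OF _ x] by simp
    ultimately show ?thesis using has_sum_imp_summable[OF h] infsumI[OF h] by simp
  qed
  moreover have "g i \<in> ground I Om" if "i \<in> B" for i using that B g_in_ground by auto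
  ultimately show ?thesis
    by (auto simp: subpermutation_def substochastic_def functions_on_def)
qed

text \<open>
  Joining every index to its at most one parent makes the tail a forest, which is 2-coloured;
  each colour class meets every set of the family at most once.
\<close>

lemma indicator_in_space:
  assumes W: "admissible_space I Om W"
  shows "(\<lambda>x. of_bool (x \<in> g ` ind)) \<in> W"
proof -
  \<comment> \<open>An index with a parent gets the opposite colour, and one without a parent gets
    \<open>True\<close>; the recursion is well-founded because parents are smaller.\<close>
  obtain col :: "nat \<Rightarrow> bool" where col: "\<And>k. col k \<longleftrightarrow> (\<forall>i\<in>parents k. \<not> col i)"
  proof -
    have "\<exists>col. \<forall>k. col k = (\<forall>i\<in>parents k. \<not> col i)"
    proof (rule dependent_wellorder_choice[where P = "\<lambda>f k r. r = (\<forall>i\<in>parents k. \<not> f i)"])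
      fix r :: bool and f h :: "nat \<Rightarrow> bool" and k assume "\<And>i. i < k \<Longrightarrow> f i = h i"
      then have "(\<forall>i\<in>parents k. \<not> f i) = (\<forall>i\<in>parents k. \<not> h i)"
        by (intro ball_cong) (auto simp: parents_def)
      then show "(r = (\<forall>i\<in>parents k. \<not> f i)) = (r = (\<forall>i\<in>parents k. \<not> h i))" by simp
    qed blast
    then show thesis using that by blast
  qed
  have alt: "col k = (\<not> col i)" if "k \<in> ind" "i \<in> parents k" for k i
  proof -
    have "k \<in> I" using that by (simp add: ind_def)
    then have "parents k = {i}" using parents_unique that by blast
    then show ?thesis using col[of k] by simp
  qed
  have sub: "(\<lambda>x. of_bool (x \<in> g ` {k \<in> ind. col k = c})) \<in> W" for c
  proof -
    have "(\<lambda>x. of_bool (x \<in> g ` {k \<in> ind. col k = c})) \<in> subpermutation I Om"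
      using alt by (intro indicator_subpermutation) auto
    then show ?thesis using W by (auto simp: admissible_space_def)
  qed
  have "(\<lambda>x. of_bool (x \<in> g ` {k \<in> ind. col k = True})) + (\<lambda>x. of_bool (x \<in> g ` {k \<in> ind. col k = False})) \<in> W"
    by (intro subspace_add sub) (use W in \<open>simp add: admissible_space_def\<close>)
  also have "(\<lambda>x. of_bool (x \<in> g ` {k \<in> ind. col k = True})) + (\<lambda>x. of_bool (x \<in> g ` {k \<in> ind. col k = False}))
      = (\<lambda>x. of_bool (x \<in> g ` ind) :: real)"
  proof
    fix x
    have "x \<notin> g ` {k \<in> ind. col k = False}" if "x \<in> g ` {k \<in> ind. col k = True}"
      using that inj_onD[OF inj_on_g] by fastforce
    then show "((\<lambda>x. of_bool (x \<in> g ` {k \<in> ind. col k = True})) + (\<lambda>x. of_bool (x \<in> g ` {k \<in> ind. col k = False}))) x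
      = (of_bool (x \<in> g ` ind) :: real)" by auto
  qed
  finally show ?thesis .
qed

text \<open>The unit sum over \<open>Om k\<close> prescribes the value at \<open>g k\<close>
  recursively. If \<open>k\<close> has a parent \<open>i\<close>, then \<open>Om k\<close> misses
  \<open>E\<close> and the value is \<open>1 - val i\<close>; otherwise it is 1 minus the mass on
  \<open>E\<close>, which \<open>high\<close> bounds. Either way it stays in the unit
  interval.\<close>

lemma stochastic_extension:
  assumes E: "finite E" and u0: "\<And>x. x \<in> E \<Longrightarrow> 0 \<le> u x"
    and low: "\<And>k. \<lbrakk>k \<in> I; k \<le> n\<rbrakk> \<Longrightarrow> sum u (Om k \<inter> E) = 1"
    and high: "\<And>k. \<lbrakk>k \<in> I; n < k\<rbrakk> \<Longrightarrow> sum u (Om k \<inter> E) \<le> 1"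
  obtains v where "v \<in> stochastic I Om" "\<And>x. x \<in> E \<Longrightarrow> v x = u x"
    "\<And>x. x \<notin> E \<union> g ` ind \<Longrightarrow> v x = 0" "\<And>k. k \<in> ind \<Longrightarrow> v (g k) \<le> 1"
proof -
  obtain val :: "nat \<Rightarrow> real" where val: "\<And>k. val k = 1 - sum u (Om k \<inter> E) - (\<Sum>i\<in>parents k. val i)"
  proof -
    have "\<exists>val. \<forall>k. val k = 1 - sum u (Om k \<inter> E) - (\<Sum>i\<in>parents k. val i)"
      by (rule dependent_wellorder_choice[where P = "\<lambda>f k r. r = 1 - sum u (Om k \<inter> E) - (\<Sum>i\<in>parents k. f i)"])
        (auto simp: parents_def intro!: sum.cong)
    then show thesis using that by blast
  qed
  have val01: "0 \<le> val k \<and> val k \<le> 1" if "k \<in> ind" for k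
    using that
  proof (induction k rule: less_induct)
    case (less k)
    then have k: "k \<in> I" "n < k" by (auto simp: ind_def)
    have nonneg: "0 \<le> sum u (Om k \<inter> E)" using u0 by (intro sum_nonneg) auto
    show ?case
      using k(1)
    proof (cases k rule: parents_cases)
      case 1
      then show ?thesis using val[of k] high[OF k] nonneg by simp
    next
      case (2 i)
      then show ?thesis using val[of k] less.IH[of i] by simp
    qed
  qed
  define v where "v x = (if x \<in> E then u x else if x \<in> g ` ind then val (the_inv_into ind g x) else 0)" for x
  have vg: "v (g k) = val k" if "k \<in> ind" for k
    using that g_notin_E[OF that] by (simp add: v_def the_inv_into_f_f[OF inj_on_g])
  have v0: "v x = 0" if "x \<notin> E \<union> g ` ind" for x using that by (auto simp: v_def)
  have vE: "v x = u x" if "x \<in> E" for x using that by (simp add: v_def)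
  have "0 \<le> v x" for x
  proof (cases "x \<in> E")
    case False
    show ?thesis
    proof (cases "x \<in> g ` ind")
      case True
      then show ?thesis using vg val01 by auto
    qed (use False v0 in auto)
  qed (simp add: vE u0)
  moreover have "(v has_sum 1) (Om k)" if k: "k \<in> I" for k
  proof -
    have sE: "sum v (Om k \<inter> E) = sum u (Om k \<inter> E)" by (rule sum.cong) (auto simp: vE)
    have "(\<Sum>i\<in>parents k. v (g i)) = (\<Sum>i\<in>parents k. val i)"
      by (rule sum.cong) (auto simp: parents_def vg)
    then have "sum v (Om k \<inter> E) + (if n < k then v (g k) + (\<Sum>i\<in>parents k. v (g i)) else 0) = 1"
      using low[OF k] vg[of k] val[of k] k sE by (auto simp: ind_def)
    then show ?thesis using has_sum_Om[OF E k, of v] v0 by simp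
  qed
  moreover have "x \<in> ground I Om" if "v x \<noteq> 0" for x
  proof -
    have "x \<in> E \<union> g ` ind" using v0 that by blast
    then show ?thesis using E_low g_in_ground by (auto simp: ground_def)
  qed
  ultimately have "v \<in> stochastic I Om" by (auto simp: stochastic_def functions_on_def)
  then show thesis using that vE v0 vg val01 by metis
qed

text \<open>In the sum over \<open>Om k\<close> the value at \<open>g k\<close> is the only unknown
  once \<open>E\<close> and the smaller representatives are settled. This uniqueness carries
  extremality from the finite part over to its completion.\<close>

lemma stochastic_determined_by_E:
  assumes E: "finite E" and ab: "a \<in> stochastic I Om" "b \<in> stochastic I Om"
    and a0: "\<And>x. x \<notin> E \<union> g ` ind \<Longrightarrow> a x = 0" and b0: "\<And>x. x \<notin> E \<union> g ` ind \<Longrightarrow> b x = 0"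
    and eq: "\<And>x. x \<in> E \<Longrightarrow> a x = b x"
  shows "a = b"
proof -
  have "a (g k) = b (g k)" if "k \<in> ind" for k
    using that
  proof (induction k rule: less_induct)
    case (less k)
    then have k: "k \<in> I" "n < k" by (auto simp: ind_def)
    have one: "sum f (Om k \<inter> E) + (f (g k) + (\<Sum>i\<in>parents k. f (g i))) = 1"
      if "f \<in> stochastic I Om" "\<And>x. x \<notin> E \<union> g ` ind \<Longrightarrow> f x = 0" for f
      using has_sum_unique[OF has_sum_Om[OF E k(1), of f]] that k by (auto simp: stochastic_def)
    have "sum a (Om k \<inter> E) = sum b (Om k \<inter> E)" by (rule sum.cong) (auto simp: eq)
    moreover have "(\<Sum>i\<in>parents k. a (g i)) = (\<Sum>i\<in>parents k. b (g i))"
      by (rule sum.cong) (auto simp: parents_def less.IH)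
    ultimately show ?case using one[of a] one[of b] ab a0 b0 by simp
  qed
  then show ?thesis using eq a0 b0 by (metis UnE ext imageE)
qed

end

text \<open>Choose \<open>g k\<close> in turn, avoiding every other set that has smaller index or
  meets \<open>E\<close> or an earlier representative; point-finiteness makes these finitely many.
  \<open>Q\<close> stays abstract because chains are built both with a lower and with an upper bound
  on \<open>\<bar>w' x\<bar>\<close>.\<close>

lemma tail_chain_exists:
  assumes point_finite: "\<And>x. x \<in> ground I Om \<Longrightarrow> finite {k \<in> I. x \<in> Om k}"
    and E: "finite E" "E \<subseteq> (\<Union>k\<in>{k \<in> I. k \<le> n}. Om k)"
    and Q: "\<And>k J. \<lbrakk>k \<in> I; n < k; finite J; J \<subseteq> I - {k}\<rbrakk> \<Longrightarrow> \<exists>x\<in>Om k - (\<Union>j\<in>J. Om j). Q k x"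
  obtains g where "tail_chain I Om n E g" "\<And>k. \<lbrakk>k \<in> I; n < k\<rbrakk> \<Longrightarrow> Q k (g k)"
proof -
  define P where "P f k r \<longleftrightarrow> (k \<in> I \<and> n < k \<longrightarrow> r \<in> Om k \<and> Q k r \<and>
    (\<forall>j\<in>I. j \<noteq> k \<longrightarrow> r \<in> Om j \<longrightarrow> k < j \<and> Om j \<inter> E = {} \<and> (\<forall>i\<in>I. n < i \<longrightarrow> i < k \<longrightarrow> f i \<notin> Om j)))"
    for f :: "nat \<Rightarrow> 'a" and k r
  have "\<exists>g. \<forall>k. P g k (g k)"
  proof (rule dependent_wellorder_choice)
    show "P f x r = P h x r" if "\<And>y. y < x \<Longrightarrow> f y = h y" for r f h x
      using that by (auto simp: P_def)
    fix k f assume IH: "\<And>i. i < k \<Longrightarrow> P f i (f i)"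
    show "\<exists>r. P f k r"
    proof (cases "k \<in> I \<and> n < k")
      case True
      define B where "B = {i \<in> I. n < i \<and> i < k}"
      define J where "J = {j \<in> I. j \<noteq> k \<and> (j < k \<or> Om j \<inter> (E \<union> f ` B) \<noteq> {})}"
      have "f ` B \<subseteq> ground I Om" using IH by (fastforce simp: B_def P_def ground_def)
      moreover have "E \<subseteq> ground I Om" using E by (auto simp: ground_def)
      moreover have "finite B" by (auto simp: B_def)
      ultimately have "finite {j \<in> I. Om j \<inter> (E \<union> f ` B) \<noteq> {}}"
        using E by (intro finite_meeting_indices[OF point_finite]) auto
      then have "finite ({..<k} \<union> {j \<in> I. Om j \<inter> (E \<union> f ` B) \<noteq> {}})" by simp
      then have "finite J" by (rule rev_finite_subset) (auto simp: J_def)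
      moreover have "J \<subseteq> I - {k}" by (auto simp: J_def)
      ultimately obtain x where "x \<in> Om k - (\<Union>j\<in>J. Om j)" "Q k x"
        using Q[of k J] True by auto
      then have "P f k x"
        unfolding P_def J_def B_def by (auto simp: not_less)
      then show ?thesis by blast
    qed (auto simp: P_def)
  qed
  then obtain g where g: "\<And>k. P g k (g k)" by blast
  have "tail_chain I Om n E g"
    using g E(2) unfolding P_def by unfold_locales blast+
  then show thesis using that g unfolding P_def by blast
qed

subsection \<open>Extreme stochastic functions\<close>

lemma summable_tail:
  fixes f :: "'a \<Rightarrow> real"
  assumes f: "f summable_on A" and "0 < \<epsilon>"
  obtains F where "finite F" "F \<subseteq> A" "infsum f (A - F) < \<epsilon>"
proof -
  obtain F where F: "finite F" "F \<subseteq> A" "dist (sum f F) (infsum f A) \<le> \<epsilon> / 2"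
    using infsum_finite_approximation[OF f, of "\<epsilon> / 2"] assms(2) by auto
  have "infsum f (F \<union> (A - F)) = infsum f F + infsum f (A - F)"
    by (intro infsum_Un_disjoint summable_on_subset_banach[OF f]) (use F in auto)
  moreover have "F \<union> (A - F) = A" using F by auto
  ultimately have "infsum f (A - F) \<le> \<epsilon> / 2" using F by (simp add: dist_real_def)
  then show thesis using that F assms(2) by force
qed

lemma summable_on_finite_UN:
  fixes f :: "'a \<Rightarrow> real"
  assumes "finite K" "\<And>k. k \<in> K \<Longrightarrow> f summable_on B k"
  shows "f summable_on (\<Union>k\<in>K. B k)"
  using assms by (induction K) (auto intro: summable_on_union)

text \<open>Unit vectors are subpermutations, and \<open>u\<close> is a finite linear combination of
  them.\<close>

lemma finite_support_in_space:
  assumes W: "admissible_space I Om W" and F: "finite F" "F \<subseteq> ground I Om"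
    and u: "\<And>x. x \<notin> F \<Longrightarrow> u x = 0"
  shows "u \<in> W"
  using F u
proof (induction F arbitrary: u)
  case empty
  then have "u = 0" by auto
  moreover have "0 \<in> W" using W unfolding admissible_space_def by (blast intro: subspace_0)
  ultimately show ?case by (simp only:)
next
  case (insert x F)
  have sub: "subspace W" using W by (simp add: admissible_space_def)
  let ?d = "\<lambda>y. of_bool (y = x) :: real"
  have "?d summable_on Om k \<and> infsum ?d (Om k) \<le> 1" for k
  proof -
    have "(?d has_sum sum ?d (Om k \<inter> {x})) (Om k)"
      by (rule has_sum_finite_neutralI[of "Om k \<inter> {x}"]) auto
    moreover have "sum ?d (Om k \<inter> {x}) \<le> 1"
      by (cases "x \<in> Om k") auto
    ultimately show ?thesis by (metis has_sum_imp_summable infsumI)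
  qed
  then have "?d \<in> subpermutation I Om"
    using insert.prems by (auto simp: subpermutation_def substochastic_def functions_on_def)
  then have "?d \<in> W" using W by (auto simp: admissible_space_def)
  moreover have "u(x := 0) \<in> W"
    using insert.prems by (intro insert.IH) auto
  ultimately have "u x *\<^sub>R ?d + u(x := 0) \<in> W"
    by (intro subspace_add[OF sub] subspace_scale[OF sub])
  also have "u x *\<^sub>R ?d + u(x := 0) = u" by auto
  finally show ?case .
qed

text \<open>
  \<open>c k\<close> is the cost which some finite avoidance condition forces on every representative of
  \<open>Om k\<close>.  A chain of representatives with at least the cost \<open>c k - 2\<^sup>-\<^sup>k\<close> has its indicator
  function in \<open>W\<close>, so these costs are summable.
\<close>

lemma tail_costs:
  assumes W: "admissible_space I Om W" and w': "w' \<in> dual_functions (ground I Om) W"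
    and point_finite: "\<And>x. x \<in> ground I Om \<Longrightarrow> finite {k \<in> I. x \<in> Om k}"
    and tail: "\<And>k J. \<lbrakk>k \<in> I; m < k; finite J; J \<subseteq> I - {k}\<rbrakk> \<Longrightarrow> \<not> Om k \<subseteq> (\<Union>j\<in>J. Om j)"
  obtains b :: "nat \<Rightarrow> real" and n0 where "b summable_on {k \<in> I. n0 < k}" "\<And>k. 0 \<le> b k"
    "\<And>k J. \<lbrakk>k \<in> I; n0 < k; finite J; J \<subseteq> I - {k}\<rbrakk> \<Longrightarrow> \<exists>x\<in>Om k - (\<Union>j\<in>J. Om j). \<bar>w' x\<bar> \<le> b k"
proof -
  \<comment> \<open>Lower bounds for \<open>\<bar>w' x\<bar>\<close> on what is left of
    \<open>Om k\<close> after removing finitely many other sets. The cap 1 makes the supremum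
    finite.\<close>
  define Lo where "Lo k = {c. 0 \<le> c \<and> c \<le> 1 \<and>
    (\<exists>J. finite J \<and> J \<subseteq> I - {k} \<and> (\<forall>x\<in>Om k - (\<Union>j\<in>J. Om j). c \<le> \<bar>w' x\<bar>))}" for k
  define c where "c k = Sup (Lo k)" for k
  \<comment> \<open>A positive summable slack: some element of \<open>Lo k\<close> exceeds
    \<open>c k - p k\<close>, whereas \<open>c k + p k\<close> lies above all of them.\<close>
  define p where "p k = ((1/2) ^ k :: real)" for k
  define b where "b k = c k + p k" for k
  have p: "0 < p k" for k by (simp add: p_def)
  have Lo0: "0 \<in> Lo k" for k unfolding Lo_def by force
  have bdd: "bdd_above (Lo k)" for k by (rule bdd_aboveI[of _ 1]) (simp add: Lo_def)
  have c0: "0 \<le> c k" for k unfolding c_def by (rule cSup_upper[OF Lo0 bdd])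
  then have b0: "0 \<le> b k" for k using less_imp_le[OF p[of k]] by (simp add: b_def)
  have costly: "\<exists>x\<in>Om k - (\<Union>j\<in>J. Om j). c k - p k \<le> \<bar>w' x\<bar>"
    if k: "k \<in> I" "m < k" and J: "finite J" "J \<subseteq> I - {k}" for k J
  proof -
    have "c k - p k < Sup (Lo k)" using p[of k] by (simp add: c_def)
    then obtain d where d: "d \<in> Lo k" "c k - p k < d"
      using less_cSupD[of "Lo k"] Lo0[of k] by blast
    then obtain J' where J': "finite J'" "J' \<subseteq> I - {k}" "\<And>x. x \<in> Om k - (\<Union>j\<in>J'. Om j) \<Longrightarrow> d \<le> \<bar>w' x\<bar>"
      unfolding Lo_def by blast
    \<comment> \<open>Avoiding \<open>J\<close> and \<open>J'\<close> together is still a finite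
      condition, so \<open>tail\<close> leaves a point; \<open>J'\<close> makes it
      expensive.\<close>
    obtain x where "x \<in> Om k - (\<Union>j\<in>J \<union> J'. Om j)"
      using tail[OF k, of "J \<union> J'"] J J' by blast
    then have x: "x \<in> Om k - (\<Union>j\<in>J. Om j)" "x \<in> Om k - (\<Union>j\<in>J'. Om j)" by auto
    show ?thesis
    proof
      show "c k - p k \<le> \<bar>w' x\<bar>" using J'(3)[OF x(2)] d(2) by linarith
    qed (rule x(1))
  qed
  obtain g where g: "tail_chain I Om m {} g" and cg: "\<And>k. \<lbrakk>k \<in> I; m < k\<rbrakk> \<Longrightarrow> c k - p k \<le> \<bar>w' (g k)\<bar>"
    using tail_chain_exists[OF point_finite finite.emptyI empty_subsetI costly] by blast
  interpret tail_chain I Om m "{}" g by (rule g)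
  have "(\<lambda>x. \<bar>of_bool (x \<in> g ` ind) * w' x\<bar>) summable_on ground I Om"
    using w' indicator_in_space[OF W] by (auto simp: dual_functions_def)
  then have "(\<lambda>x. \<bar>of_bool (x \<in> g ` ind) * w' x\<bar>) summable_on g ` ind"
    by (rule summable_on_subset_banach) (use g_in_ground in auto)
  then have "(\<lambda>k. \<bar>of_bool (g k \<in> g ` ind) * w' (g k)\<bar>) summable_on ind"
    by (subst (asm) summable_on_reindex[OF inj_on_g]) (simp add: o_def)
  then have sw: "(\<lambda>k. \<bar>w' (g k)\<bar>) summable_on ind"
    by (rule summable_on_cong[THEN iffD1, rotated]) auto
  have "p summable_on UNIV"
    unfolding p_def by (subst summable_on_UNIV_nonneg_real_iff) (auto intro: summable_geometric)
  \<comment> \<open>The factor 2 arises because \<open>b k\<close> exceeds the realised cost bound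
    \<open>c k - p k\<close> by \<open>2 * p k\<close>.\<close>
  then have "(\<lambda>k. 2 * p k) summable_on ind"
    by (intro summable_on_cmult_right) (rule summable_on_subset_banach, auto)
  then have "(\<lambda>k. \<bar>w' (g k)\<bar> + 2 * p k) summable_on ind" by (intro summable_on_add sw)
  then have sb: "b summable_on ind"
    by (rule summable_on_comparison_test) (use cg b0 in \<open>force simp: b_def ind_def\<close>)+
  \<comment> \<open>Beyond finitely many indices \<open>b k < 1\<close>, so there the cap in
    \<open>Lo k\<close> does not exclude \<open>b k\<close>.\<close>
  obtain F where F: "finite F" "F \<subseteq> ind" "infsum b (ind - F) < 1"
    using summable_tail[OF sb, of 1] by auto
  have b1: "b k < 1" if "k \<in> ind - F" for k
  proof -
    have "sum b {k} \<le> infsum b (ind - F)"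
      by (rule finite_sum_le_infsum) (use that b0 in \<open>auto intro: summable_on_subset_banach[OF sb]\<close>)
    then show ?thesis using F by simp
  qed
  define n0 where "n0 = Max (insert m F)"
  have m: "m \<le> n0" using F by (simp add: n0_def)
  show thesis
  proof (rule that[of b n0])
    show "b summable_on {k \<in> I. n0 < k}"
      by (rule summable_on_subset_banach[OF sb]) (use m in \<open>auto simp: ind_def\<close>)
    show "0 \<le> b k" for k by (rule b0)
    fix k J assume k: "k \<in> I" "n0 < k" and J: "finite J" "J \<subseteq> I - {k}"
    show "\<exists>x\<in>Om k - (\<Union>j\<in>J. Om j). \<bar>w' x\<bar> \<le> b k"
    proof (rule ccontr)
      assume "\<not> ?thesis"
      \<comment> \<open>If every remaining point cost more than \<open>b k\<close>, then
        \<open>b k\<close> would belong to \<open>Lo k\<close> although it exceeds its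
        supremum.\<close>
      then have *: "\<forall>x\<in>Om k - (\<Union>j\<in>J. Om j). b k \<le> \<bar>w' x\<bar>" by force
      have "k \<notin> F" using k F by (auto simp: n0_def)
      then have "b k < 1" using k m by (intro b1) (auto simp: ind_def)
      then have "b k \<in> Lo k" using * J b0 by (auto simp: Lo_def)
      then have "b k \<le> c k" unfolding c_def by (rule cSup_upper[OF _ bdd])
      then show False using p[of k] by (simp add: b_def)
    qed
  qed
qed

section \<open>Reduction of a stochastic function to a polytope of functions with finite
  support\<close>

definition level_polytope :: "nat set \<Rightarrow> (nat \<Rightarrow> 'a set) \<Rightarrow> nat \<Rightarrow> 'a set \<Rightarrow> ('a \<Rightarrow> real) set" where
  "level_polytope I Om n F = {u \<in> functions_on F. (\<forall>x\<in>F. 0 \<le> u x) \<and>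
     (\<forall>k\<in>I. k \<le> n \<longrightarrow> sum u (Om k \<inter> F) = 1) \<and> (\<forall>k\<in>I. n < k \<longrightarrow> sum u (Om k \<inter> F) \<le> 1)}"

text \<open>Sets that miss \<open>F\<close> give the trivial constraint \<open>0 \<le> 1\<close>, so
  by point-finiteness only finitely many inequalities remain. Boundedness holds because
  \<open>F\<close> is covered by sets with prescribed sum 1: if one of two distinct elements of
  \<open>E\<close> dominated the other, their sums over such a set would differ.\<close>

lemma level_polytope_extreme_point_ge:
  assumes point_finite: "\<And>x. x \<in> ground I Om \<Longrightarrow> finite {k \<in> I. x \<in> Om k}"
    and F: "finite F" "F \<subseteq> (\<Union>k\<in>{k \<in> I. k \<le> n}. Om k)" and u: "u \<in> level_polytope I Om n F"
  obtains e where "e extreme_point_of level_polytope I Om n F" "(\<Sum>x\<in>F. u x * a x) \<le> (\<Sum>x\<in>F. e x * a x)"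
proof -
  define E where "E = {u \<in> functions_on F. \<forall>k\<in>I. k \<le> n \<longrightarrow> sum u (Om k \<inter> F) = 1}"
  define A where "A = F <+> {k \<in> I. n < k \<and> Om k \<inter> F \<noteq> {}}"
  define l where "l = case_sum (\<lambda>x (u :: 'a \<Rightarrow> real). u x) (\<lambda>k u. 1 - sum u (Om k \<inter> F))"
  have sum_affine: "(\<Sum>x\<in>B. (x0 + t *\<^sub>R (z - y)) x * c x) = (\<Sum>x\<in>B. x0 x * c x) + t * ((\<Sum>x\<in>B. z x * c x) - (\<Sum>x\<in>B. y x * c x))"
    for B and x0 y z c :: "'a \<Rightarrow> real" and t
    by (simp add: sum.distrib sum_distrib_left sum_subtractf algebra_simps)
  have sum_affine1: "sum (x + t *\<^sub>R (z - y)) B = sum x B + t * (sum z B - sum y B)"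
    for B and x y z :: "'a \<Rightarrow> real" and t
    using sum_affine[where c = "\<lambda>_. 1"] by simp
  have P: "level_polytope I Om n F = {u \<in> E. \<forall>i\<in>A. 0 \<le> l i u}"
  proof -
    have "(\<forall>k\<in>I. n < k \<longrightarrow> sum u (Om k \<inter> F) \<le> 1) \<longleftrightarrow>
        (\<forall>k\<in>{k \<in> I. n < k \<and> Om k \<inter> F \<noteq> {}}. sum u (Om k \<inter> F) \<le> 1)" for u :: "'a \<Rightarrow> real"
    proof
      assume *: "\<forall>k\<in>{k \<in> I. n < k \<and> Om k \<inter> F \<noteq> {}}. sum u (Om k \<inter> F) \<le> 1"
      show "\<forall>k\<in>I. n < k \<longrightarrow> sum u (Om k \<inter> F) \<le> 1"
      proof (intro ballI impI)
        fix k assume "k \<in> I" "n < k"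
        then show "sum u (Om k \<inter> F) \<le> 1" using * by (cases "Om k \<inter> F = {}") auto
      qed
    qed auto
    moreover have "(\<forall>i\<in>A. 0 \<le> l i u) \<longleftrightarrow> (\<forall>x\<in>F. 0 \<le> u x) \<and>
        (\<forall>k\<in>{k \<in> I. n < k \<and> Om k \<inter> F \<noteq> {}}. sum u (Om k \<inter> F) \<le> 1)" for u
      by (simp add: A_def l_def Plus_def ball_Un)
    ultimately show ?thesis by (auto simp: level_polytope_def E_def)
  qed
  have "\<exists>e. e extreme_point_of {u \<in> E. \<forall>i\<in>A. 0 \<le> l i u} \<and> (\<Sum>x\<in>F. u x * a x) \<le> (\<Sum>x\<in>F. e x * a x)"
  proof (rule polyhedron_extreme_point_ge)
    have "F \<subseteq> ground I Om" using F by (auto simp: ground_def)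
    then have "finite {k \<in> I. Om k \<inter> F \<noteq> {}}" using point_finite F by (intro finite_meeting_indices)
    then have "finite {k \<in> I. n < k \<and> Om k \<inter> F \<noteq> {}}" by (rule rev_finite_subset) auto
    then show "finite A" using F by (simp add: A_def)
    show "x + t *\<^sub>R (z - y) \<in> E" if "x \<in> E" "y \<in> E" "z \<in> E" for x y z t
    proof -
      have "sum (x + t *\<^sub>R (z - y)) (Om k \<inter> F) = 1" if "k \<in> I" "k \<le> n" for k
        unfolding sum_affine1 using \<open>x \<in> E\<close> \<open>y \<in> E\<close> \<open>z \<in> E\<close> that by (simp add: E_def)
      moreover have "x + t *\<^sub>R (z - y) \<in> functions_on F"
        using that by (simp add: E_def functions_on_def)
      ultimately show ?thesis unfolding E_def by blast
    qed
    show "l i (x + t *\<^sub>R (z - y)) = l i x + t * (l i z - l i y)" for i x y z t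
    proof (cases i)
      case (Inl h)
      then show ?thesis by (simp add: l_def)
    next
      case (Inr k)
      show ?thesis unfolding Inr l_def sum.case sum_affine1 by (simp add: algebra_simps)
    qed
    show "(\<Sum>x\<in>F. (x0 + t *\<^sub>R (z - y)) x * a x) = (\<Sum>x\<in>F. x0 x * a x) + t * ((\<Sum>x\<in>F. z x * a x) - (\<Sum>x\<in>F. y x * a x))"
      for x0 y z t by (rule sum_affine)
    show "\<exists>i\<in>A. l i x < l i y" if xy: "x \<in> E" "y \<in> E" "x \<noteq> y" for x y
    proof -
      have "\<exists>h\<in>F. x h < y h"
      proof (rule ccontr)
        assume "\<not> ?thesis"
        then have le: "y h \<le> x h" if "h \<in> F" for h using that by force
        obtain h where h: "x h \<noteq> y h" using xy(3) by auto
        then have "h \<in> F" using xy by (auto simp: E_def functions_on_def)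
        then obtain k where k: "k \<in> I" "k \<le> n" "h \<in> Om k \<inter> F" using F by auto
        have "sum y (Om k \<inter> F) < sum x (Om k \<inter> F)"
        proof (rule sum_strict_mono_ex1)
          show "\<exists>h\<in>Om k \<inter> F. y h < x h" using k(3) h le[of h] by force
        qed (use F le in auto)
        then show False using xy k by (simp add: E_def)
      qed
      then obtain h where "h \<in> F" "x h < y h" by blast
      then show ?thesis by (intro bexI[of _ "Inl h"]) (auto simp: A_def l_def)
    qed
    show "0 \<le> l i u" if "i \<in> A" for i using u that unfolding P by auto
    show "u \<in> E" using u unfolding P by auto
  qed
  then show thesis using that unfolding P by blast
qed

text \<open>Keep \<open>w\<close> on a finite set \<open>G\<close> that leaves mass less than 1, and
  merge the rest by type. Sums over sets of index at most \<open>N\<close> are preserved on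
  \<open>Y\<close>; sets of larger index miss \<open>G\<close>, so they receive at most the
  remaining mass.\<close>

lemma level_reduction:
  fixes n :: nat
  assumes w: "w \<in> stochastic I Om" and wa: "(\<lambda>x. w x * a x) summable_on ground I Om"
    and point_finite: "\<And>x. x \<in> ground I Om \<Longrightarrow> finite {k \<in> I. x \<in> Om k}"
  defines "Y \<equiv> (\<Union>k\<in>{k \<in> I. k \<le> n}. Om k)"
  obtains F u where "finite F" "F \<subseteq> Y" "u \<in> level_polytope I Om n F"
    "(\<Sum>\<^sub>\<infinity>x\<in>Y. w x * a x) \<le> (\<Sum>x\<in>F. u x * a x)"
proof -
  have w0: "0 \<le> w x" for x using w by (simp add: stochastic_def)
  have wk: "(w has_sum 1) (Om k)" if "k \<in> I" for k using w that by (simp add: stochastic_def)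
  have Yg: "Y \<subseteq> ground I Om" by (auto simp: Y_def ground_def)
  have sY: "w summable_on Y"
    unfolding Y_def using wk by (intro summable_on_finite_UN) (auto intro: has_sum_imp_summable)
  have saY: "(\<lambda>x. w x * a x) summable_on Y" by (rule summable_on_subset_banach[OF wa Yg])
  obtain G where G: "finite G" "G \<subseteq> Y" "infsum w (Y - G) < 1"
    using summable_tail[OF sY, of 1] by auto
  \<comment> \<open>Including \<open>n\<close> ensures that the sums required to be exactly 1 are
    among the preserved ones.\<close>
  define N where "N = Max (insert n {k \<in> I. Om k \<inter> G \<noteq> {}})"
  have fin: "finite {k \<in> I. Om k \<inter> G \<noteq> {}}"
    using finite_meeting_indices[OF point_finite G(1)] G(2) Yg by blast
  have nN: "n \<le> N" using fin by (simp add: N_def)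
  have offG: "Om k \<inter> G = {}" if "k \<in> I" "N < k" for k
  proof (rule ccontr)
    assume "Om k \<inter> G \<noteq> {}"
    then have "k \<le> N" unfolding N_def using that fin by (intro Max_ge) auto
    then show False using that by simp
  qed
  define R where "R = Y - G"
  define \<tau> where "\<tau> x = {k \<in> I. k \<le> N \<and> x \<in> Om k}" for x
  have RY: "R \<subseteq> Y" by (auto simp: R_def)
  have "\<tau> ` R \<subseteq> Pow {..N}" by (auto simp: \<tau>_def)
  then have fin\<tau>: "finite (\<tau> ` R)" by (rule finite_subset) simp
  obtain F1 u1 where F1: "finite F1" "F1 \<subseteq> R" and u1: "\<forall>x. x \<notin> F1 \<longrightarrow> u1 x = 0" "\<forall>x. 0 \<le> u1 x"
    and sat: "\<forall>S\<subseteq>R. (\<forall>x\<in>S. \<forall>y\<in>R. \<tau> y = \<tau> x \<longrightarrow> y \<in> S) \<longrightarrow> sum u1 (F1 \<inter> S) = infsum w S"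
    and u1a: "(\<Sum>\<^sub>\<infinity>x\<in>R. w x * a x) \<le> (\<Sum>x\<in>F1. u1 x * a x)"
    by (rule finite_support_reduction[OF w0 summable_on_subset_banach[OF sY RY]
          summable_on_subset_banach[OF saY RY] fin\<tau>])
  define F where "F = G \<union> F1"
  define u where "u x = (if x \<in> G then w x else u1 x)" for x
  have disj: "G \<inter> F1 = {}" using F1 by (auto simp: R_def)
  \<comment> \<open>The weight \<open>c\<close> is taken as 1 for the sums over \<open>Om k\<close>
    and as \<open>a\<close> for the linear objective.\<close>
  have sumF: "(\<Sum>x\<in>B \<inter> F. u x * c x) = (\<Sum>x\<in>B \<inter> G. w x * c x) + (\<Sum>x\<in>B \<inter> F1. u1 x * c x)" for B c
  proof -
    have "(\<Sum>x\<in>B \<inter> F. u x * c x) = (\<Sum>x\<in>B \<inter> G. u x * c x) + (\<Sum>x\<in>B \<inter> F1. u x * c x)"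
      unfolding F_def Int_Un_distrib by (rule sum.union_disjoint) (use G F1 disj in auto)
    moreover have "(\<Sum>x\<in>B \<inter> G. u x * c x) = (\<Sum>x\<in>B \<inter> G. w x * c x)"
      by (rule sum.cong) (auto simp: u_def)
    moreover have "(\<Sum>x\<in>B \<inter> F1. u x * c x) = (\<Sum>x\<in>B \<inter> F1. u1 x * c x)"
      by (rule sum.cong) (use disj in \<open>auto simp: u_def\<close>)
    ultimately show ?thesis by simp
  qed
  have sumk: "sum u (Om k \<inter> F) = infsum w (Om k \<inter> Y)" if k: "k \<in> I" "k \<le> N" for k
  proof -
    have "sum u1 (F1 \<inter> (Om k \<inter> R)) = infsum w (Om k \<inter> R)"
      using k by (intro sat[rule_format]) (auto simp: \<tau>_def)
    moreover have "F1 \<inter> (Om k \<inter> R) = Om k \<inter> F1" using F1 by auto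
    moreover have "infsum w ((Om k \<inter> G) \<union> (Om k \<inter> R)) = infsum w (Om k \<inter> G) + infsum w (Om k \<inter> R)"
      by (intro infsum_Un_disjoint summable_on_subset_banach[OF sY]) (use G in \<open>auto simp: R_def\<close>)
    moreover have "(Om k \<inter> G) \<union> (Om k \<inter> R) = Om k \<inter> Y" using G by (auto simp: R_def)
    moreover have "infsum w (Om k \<inter> G) = sum w (Om k \<inter> G)" using G by (intro infsum_finite) auto
    ultimately show ?thesis using sumF[where B = "Om k" and c = "\<lambda>_. 1"] by simp
  qed
  have "sum u (Om k \<inter> F) = 1" if k: "k \<in> I" "k \<le> n" for k
  proof -
    have "Om k \<inter> Y = Om k" using k by (auto simp: Y_def)
    then show ?thesis using sumk[of k] k nN infsumI[OF wk[OF k(1)]] by simp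
  qed
  moreover have "sum u (Om k \<inter> F) \<le> 1" if k: "k \<in> I" "n < k" for k
  proof (cases "k \<le> N")
    case True
    have "infsum w (Om k \<inter> Y) \<le> infsum w (Om k)"
      using w0 by (intro infsum_mono2 summable_on_subset_banach[OF has_sum_imp_summable[OF wk[OF k(1)]]]) auto
    then show ?thesis using sumk[OF k(1) True] infsumI[OF wk[OF k(1)]] by simp
  next
    case False
    have "sum u (Om k \<inter> F) = sum u1 (Om k \<inter> F1)"
      using sumF[where B = "Om k" and c = "\<lambda>_. 1"] offG[OF k(1)] False by simp
    also have "\<dots> \<le> sum u1 F1" by (rule sum_mono2) (use F1 u1 in auto)
    also have "sum u1 F1 = infsum w R"
      using sat[rule_format, of R] F1 by (simp add: Int_absorb2)
    finally show ?thesis using G(3) by (simp add: R_def)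
  qed
  moreover have "u \<in> functions_on F" using u1 by (auto simp: functions_on_def u_def F_def)
  ultimately have "u \<in> level_polytope I Om n F"
    using w0 u1(2) by (auto simp: level_polytope_def u_def)
  moreover have "(\<Sum>\<^sub>\<infinity>x\<in>Y. w x * a x) \<le> (\<Sum>x\<in>F. u x * a x)"
  proof -
    have "(\<Sum>\<^sub>\<infinity>x\<in>G \<union> R. w x * a x) = (\<Sum>\<^sub>\<infinity>x\<in>G. w x * a x) + (\<Sum>\<^sub>\<infinity>x\<in>R. w x * a x)"
      by (intro infsum_Un_disjoint summable_on_subset_banach[OF saY]) (use G in \<open>auto simp: R_def\<close>)
    moreover have "G \<union> R = Y" using G by (auto simp: R_def)
    ultimately show ?thesis using u1a sumF[where B = UNIV and c = a] G by simp
  qed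
  moreover have "finite F" "F \<subseteq> Y" using G F1 RY by (auto simp: F_def)
  ultimately show thesis using that by blast
qed

text \<open>If the completion lies strictly between \<open>a\<close> and \<open>b\<close>, both
  vanish where it does. Their restrictions to \<open>E\<close> lie in the polytope with
  \<open>e\<close> strictly between unless they coincide, so extremality gives \<open>a = b\<close>
  on \<open>E\<close> and hence everywhere. Membership in \<open>W\<close> holds since the part off
  \<open>E\<close> is dominated by the indicator of the representatives.\<close>

lemma (in tail_chain) extreme_point_extension:
  assumes W: "admissible_space I Om W" and E: "finite E"
    and e: "e extreme_point_of level_polytope I Om n E"
  obtains v where "v extreme_point_of (stochastic I Om \<inter> W)" "\<And>x. x \<in> E \<Longrightarrow> v x = e x"
    "\<And>x. x \<notin> E \<union> g ` ind \<Longrightarrow> v x = 0" "\<And>k. k \<in> ind \<Longrightarrow> v (g k) \<le> 1"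
proof -
  have eP: "e \<in> level_polytope I Om n E" using e by (simp add: extreme_point_of_def)
  obtain v where v: "v \<in> stochastic I Om" and vE: "\<And>x. x \<in> E \<Longrightarrow> v x = e x"
    and v0: "\<And>x. x \<notin> E \<union> g ` ind \<Longrightarrow> v x = 0" and v1: "\<And>k. k \<in> ind \<Longrightarrow> v (g k) \<le> 1"
    by (rule stochastic_extension[OF E, of e]) (use eP in \<open>auto simp: level_polytope_def\<close>)
  have vpos: "0 \<le> v x" for x using v by (simp add: stochastic_def)
  have sub: "subspace W" using W by (simp add: admissible_space_def)
  define v_low where "v_low x = (if x \<in> E then v x else 0)" for x
  define v_tail where "v_tail x = (if x \<in> E then 0 else v x)" for x
  have Eg: "E \<subseteq> ground I Om" using E_low by (auto simp: ground_def)
  have "v_low \<in> W" using finite_support_in_space[OF W E Eg, of v_low] by (simp add: v_low_def)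
  moreover have "v_tail \<in> W"
  proof -
    have "v_tail \<in> functions_on (ground I Om)"
      using v by (auto simp: v_tail_def stochastic_def functions_on_def)
    moreover have "\<bar>v_tail x\<bar> \<le> \<bar>of_bool (x \<in> g ` ind)\<bar>" for x
      using v0[of x] v1 vpos by (auto simp: v_tail_def)
    moreover have "\<forall>w\<in>W. \<forall>v\<in>functions_on (ground I Om). (\<forall>x. \<bar>v x\<bar> \<le> \<bar>w x\<bar>) \<longrightarrow> v \<in> W"
      using W by (simp add: admissible_space_def)
    ultimately show ?thesis using indicator_in_space[OF W] by meson
  qed
  ultimately have "v_low + v_tail \<in> W" by (rule subspace_add[OF sub])
  moreover have "v_low + v_tail = v" by (auto simp: v_low_def v_tail_def)
  ultimately have vW: "v \<in> W" by simp
  have "v extreme_point_of (stochastic I Om \<inter> W)"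
    unfolding extreme_point_of_def
  proof (intro conjI ballI)
    show "v \<in> stochastic I Om \<inter> W" using v vW by simp
    fix a b assume ab: "a \<in> stochastic I Om \<inter> W" "b \<in> stochastic I Om \<inter> W"
    show "v \<notin> open_segment a b"
    proof
      assume "v \<in> open_segment a b"
      then obtain s where s: "0 < s" "s < 1" and ne: "a \<noteq> b" and vs: "v = (1 - s) *\<^sub>R a + s *\<^sub>R b"
        by (auto simp: in_segment)
      have vx: "v x = (1 - s) * a x + s * b x" for x by (simp add: vs)
      have pos: "0 \<le> a x" "0 \<le> b x" for x using ab by (auto simp: stochastic_def)
      have supp: "a x = 0 \<and> b x = 0" if "x \<notin> E \<union> g ` ind" for x
      proof -
        have "(1 - s) * a x = 0 \<and> s * b x = 0"
          using vx[of x] v0[OF that] pos[of x] s by (subst add_nonneg_eq_0_iff[symmetric]) auto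
        then show ?thesis using s by simp
      qed
      define res where "res f x = (if x \<in> E then f x else 0)" for f :: "'a \<Rightarrow> real" and x
      \<comment> \<open>Restriction to \<open>E\<close> drops only values at representatives: low
        sets contain none and keep sum 1, and the others can only lose mass.\<close>
      have resP: "res f \<in> level_polytope I Om n E"
        if f: "f \<in> stochastic I Om" "\<And>x. x \<notin> E \<union> g ` ind \<Longrightarrow> f x = 0" for f
      proof -
        have f0: "0 \<le> f x" for x using f by (simp add: stochastic_def)
        have one: "sum (res f) (Om k \<inter> E) + (if n < k then f (g k) + (\<Sum>i\<in>parents k. f (g i)) else 0) = 1"
          if k: "k \<in> I" for k
        proof -
          have "sum (res f) (Om k \<inter> E) = sum f (Om k \<inter> E)" by (rule sum.cong) (auto simp: res_def)
          moreover have "(f has_sum 1) (Om k)" using f k by (simp add: stochastic_def)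
          ultimately show ?thesis
            using has_sum_unique[OF has_sum_Om[OF E k, of f]] f(2) by simp
        qed
        have nonneg: "0 \<le> f (g k) + (\<Sum>i\<in>parents k. f (g i))" for k
          using f0 by (intro add_nonneg_nonneg sum_nonneg) auto
        have "sum (res f) (Om k \<inter> E) \<le> 1 \<and> (k \<le> n \<longrightarrow> sum (res f) (Om k \<inter> E) = 1)"
          if "k \<in> I" for k
          using one[OF that] nonneg[of k] by (auto split: if_splits)
        then show ?thesis using f0 by (auto simp: level_polytope_def functions_on_def res_def)
      qed
      have "res a = res b"
      proof (rule ccontr)
        assume "res a \<noteq> res b"
        moreover have "e = (1 - s) *\<^sub>R res a + s *\<^sub>R res b"
        proof
          fix x
          show "e x = ((1 - s) *\<^sub>R res a + s *\<^sub>R res b) x"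
            using vE[of x] vx[of x] eP by (auto simp: res_def level_polytope_def functions_on_def)
        qed
        ultimately have "e \<in> open_segment (res a) (res b)" using s by (auto simp: in_segment)
        moreover have "res a \<in> level_polytope I Om n E" "res b \<in> level_polytope I Om n E"
          using resP ab supp by auto
        ultimately show False using e by (auto simp: extreme_point_of_def)
      qed
      then have "a x = b x" if "x \<in> E" for x using that by (auto simp: res_def fun_eq_iff split: if_splits)
      then have "a = b" using stochastic_determined_by_E[OF E, of a b] ab supp by blast
      then show False using ne by simp
    qed
  qed
  then show thesis using that vE v0 v1 by blast
qed

lemma extreme_point_almost_above:
  assumes W: "admissible_space I Om W" and w': "w' \<in> dual_functions (ground I Om) W"
    and point_finite: "\<And>x. x \<in> ground I Om \<Longrightarrow> finite {k \<in> I. x \<in> Om k}"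
    and tail: "\<And>k J. \<lbrakk>k \<in> I; m < k; finite J; J \<subseteq> I - {k}\<rbrakk> \<Longrightarrow> \<not> Om k \<subseteq> (\<Union>j\<in>J. Om j)"
    and w: "w \<in> stochastic I Om \<inter> W" and \<epsilon>: "0 < \<epsilon>"
  obtains v where "v extreme_point_of (stochastic I Om \<inter> W)"
    "pairing (ground I Om) w w' - \<epsilon> \<le> pairing (ground I Om) v w'"
proof -
  let ?X = "ground I Om"
  have abs_summable: "(\<lambda>x. \<bar>u x * w' x\<bar>) summable_on ?X" if "u \<in> W" for u
    using w' that by (simp add: dual_functions_def)
  then have summable: "(\<lambda>x. u x * w' x) summable_on ?X" if "u \<in> W" for u
    using that by (subst summable_on_iff_abs_summable_on_real) simp
  obtain b n0 where sb: "b summable_on {k \<in> I. n0 < k}" and b0: "\<And>k. 0 \<le> b k"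
    and cheap: "\<And>k J. \<lbrakk>k \<in> I; n0 < k; finite J; J \<subseteq> I - {k}\<rbrakk> \<Longrightarrow> \<exists>x\<in>Om k - (\<Union>j\<in>J. Om j). \<bar>w' x\<bar> \<le> b k"
    using tail_costs[OF W w' point_finite tail] by blast
  obtain K where K: "finite K" "K \<subseteq> {k \<in> I. n0 < k}" "infsum b ({k \<in> I. n0 < k} - K) < \<epsilon> / 2"
    using summable_tail[OF sb, of "\<epsilon> / 2"] \<epsilon> by auto
  have wW: "w \<in> W" and wS: "w \<in> stochastic I Om" using w by auto
  obtain G where G: "finite G" "G \<subseteq> ?X" "(\<Sum>\<^sub>\<infinity>x\<in>?X - G. \<bar>w x * w' x\<bar>) < \<epsilon> / 2"
    using summable_tail[OF abs_summable[OF wW], of "\<epsilon> / 2"] \<epsilon> by auto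
  have "\<exists>k. k \<in> I \<and> x \<in> Om k" if "x \<in> G" for x using that G by (auto simp: ground_def)
  then obtain idx where idx: "\<And>x. x \<in> G \<Longrightarrow> idx x \<in> I \<and> x \<in> Om (idx x)" by metis
  \<comment> \<open>Large enough that representatives above \<open>n\<close> are cheap, that their
    costs form a tail below \<open>\<epsilon> / 2\<close>, and that \<open>Y\<close> contains
    \<open>G\<close>, off which \<open>w\<close> contributes less than
    \<open>\<epsilon> / 2\<close>.\<close>
  define n where "n = Max (insert n0 (K \<union> idx ` G))"
  have n_ge: "k \<le> n" if "k \<in> insert n0 (K \<union> idx ` G)" for k
    unfolding n_def using that K G by (intro Max_ge) auto
  define Y where "Y = (\<Union>k\<in>{k \<in> I. k \<le> n}. Om k)"
  have YX: "Y \<subseteq> ?X" by (auto simp: Y_def ground_def)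
  have GY: "G \<subseteq> Y" using idx n_ge by (fastforce simp: Y_def)
  have low: "pairing ?X w w' - \<epsilon> / 2 \<le> (\<Sum>\<^sub>\<infinity>x\<in>Y. w x * w' x)"
  proof -
    have "infsum (\<lambda>x. w x * w' x) (Y \<union> (?X - Y)) = (\<Sum>\<^sub>\<infinity>x\<in>Y. w x * w' x) + (\<Sum>\<^sub>\<infinity>x\<in>?X - Y. w x * w' x)"
      by (intro infsum_Un_disjoint summable_on_subset_banach[OF summable[OF wW]]) (use YX in auto)
    moreover have "Y \<union> (?X - Y) = ?X" using YX by auto
    moreover have "(\<Sum>\<^sub>\<infinity>x\<in>?X - Y. w x * w' x) \<le> (\<Sum>\<^sub>\<infinity>x\<in>?X - Y. \<bar>w x * w' x\<bar>)"
      by (intro infsum_mono summable_on_subset_banach[OF summable[OF wW]]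
          summable_on_subset_banach[OF abs_summable[OF wW]]) auto
    moreover have "\<dots> \<le> (\<Sum>\<^sub>\<infinity>x\<in>?X - G. \<bar>w x * w' x\<bar>)"
      by (intro infsum_mono2 summable_on_subset_banach[OF abs_summable[OF wW]]) (use GY in auto)
    ultimately show ?thesis using G(3) by (simp add: pairing_def)
  qed
  obtain F u where F: "finite F" "F \<subseteq> Y" and u: "u \<in> level_polytope I Om n F"
    and wu: "(\<Sum>\<^sub>\<infinity>x\<in>Y. w x * w' x) \<le> (\<Sum>x\<in>F. u x * w' x)"
    unfolding Y_def by (rule level_reduction[OF wS summable[OF wW] point_finite])
  note FY = F(2)[unfolded Y_def]
  obtain e where e: "e extreme_point_of level_polytope I Om n F"
    and ue: "(\<Sum>x\<in>F. u x * w' x) \<le> (\<Sum>x\<in>F. e x * w' x)"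
    by (rule level_polytope_extreme_point_ge[OF point_finite F(1) FY u])
  have n0: "n0 \<le> n" by (rule n_ge) simp
  have cheap': "\<exists>x\<in>Om k - (\<Union>j\<in>J. Om j). \<bar>w' x\<bar> \<le> b k"
    if "k \<in> I" "n < k" "finite J" "J \<subseteq> I - {k}" for k J
    using cheap[of k J] that n0 by simp
  obtain g where g: "tail_chain I Om n F g" and gb: "\<And>k. \<lbrakk>k \<in> I; n < k\<rbrakk> \<Longrightarrow> \<bar>w' (g k)\<bar> \<le> b k"
    using tail_chain_exists[OF point_finite F(1) FY cheap'] by blast
  interpret tail_chain I Om n F g by (rule g)
  obtain v where v: "v extreme_point_of (stochastic I Om \<inter> W)" and vE: "\<And>x. x \<in> F \<Longrightarrow> v x = e x"
    and v0: "\<And>x. x \<notin> F \<union> g ` ind \<Longrightarrow> v x = 0" and v1: "\<And>k. k \<in> ind \<Longrightarrow> v (g k) \<le> 1"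
    using extreme_point_extension[OF W F(1) e] by blast
  have vW: "v \<in> W" and vpos: "0 \<le> v x" for x
    using v by (auto simp: extreme_point_of_def stochastic_def)
  have supp: "F \<union> g ` ind \<subseteq> ?X" using F(2) YX g_in_ground by blast
  have sg: "(\<lambda>x. v x * w' x) summable_on g ` ind"
    by (rule summable_on_subset_banach[OF summable[OF vW]]) (use supp in auto)
  have "pairing ?X v w' = infsum (\<lambda>x. v x * w' x) (F \<union> g ` ind)"
    unfolding pairing_def using supp v0 by (intro infsum_cong_neutral) auto
  also have "\<dots> = (\<Sum>x\<in>F. v x * w' x) + (\<Sum>\<^sub>\<infinity>x\<in>g ` ind. v x * w' x)"
    using F(1) sg g_notin_E by (subst infsum_Un_disjoint) auto
  also have "(\<Sum>x\<in>F. v x * w' x) = (\<Sum>x\<in>F. e x * w' x)"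
    by (rule sum.cong) (auto simp: vE)
  finally have vsum: "pairing ?X v w' = (\<Sum>x\<in>F. e x * w' x) + (\<Sum>\<^sub>\<infinity>x\<in>g ` ind. v x * w' x)" .
  have ind_sub: "ind \<subseteq> {k \<in> I. n0 < k} - K" using n_ge by (fastforce simp: ind_def)
  have sb': "b summable_on ind" by (rule summable_on_subset_banach[OF sb]) (use ind_sub in auto)
  have "infsum b ind \<le> infsum b ({k \<in> I. n0 < k} - K)"
    by (intro infsum_mono2 sb' summable_on_subset_banach[OF sb]) (use ind_sub b0 in auto)
  moreover have "- infsum b ind \<le> (\<Sum>\<^sub>\<infinity>x\<in>g ` ind. v x * w' x)"
  proof -
    have "(\<Sum>\<^sub>\<infinity>k\<in>ind. - b k) \<le> (\<Sum>\<^sub>\<infinity>k\<in>ind. v (g k) * w' (g k))"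
    proof (rule infsum_mono)
      show "(\<lambda>k. - b k) summable_on ind" using sb' by (simp add: summable_on_uminus)
      show "(\<lambda>k. v (g k) * w' (g k)) summable_on ind"
        using sg by (subst (asm) summable_on_reindex[OF inj_on_g]) (simp add: o_def)
      fix k assume k: "k \<in> ind"
      have "\<bar>v (g k) * w' (g k)\<bar> \<le> 1 * b k"
        unfolding abs_mult using k v1 vpos gb by (intro mult_mono) (auto simp: ind_def)
      then show "- b k \<le> v (g k) * w' (g k)" by linarith
    qed
    moreover have "(\<Sum>\<^sub>\<infinity>x\<in>g ` ind. v x * w' x) = (\<Sum>\<^sub>\<infinity>k\<in>ind. v (g k) * w' (g k))"
      by (subst infsum_reindex[OF inj_on_g]) (simp add: o_def)
    ultimately show ?thesis by (simp add: infsum_uminus)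
  qed
  ultimately have "pairing ?X w w' - \<epsilon> \<le> pairing ?X v w'"
    using low wu ue vsum K(3) by linarith
  then show thesis by (rule that[OF v])
qed

section \<open>Density of the convex hull of the extreme points, and closedness\<close>

lemma finite_index_if_finite_cover:
  assumes w: "w \<in> stochastic I Om"
    and point_finite: "\<And>x. x \<in> ground I Om \<Longrightarrow> finite {k \<in> I. x \<in> Om k}"
    and cover: "finite K" "K \<subseteq> I" "ground I Om = (\<Union>k\<in>K. Om k)"
  shows "finite I"
proof -
  have wk: "(w has_sum 1) (Om k)" if "k \<in> I" for k using w that by (simp add: stochastic_def)
  have s: "w summable_on ground I Om"
    unfolding cover(3) using cover(1,2) wk by (intro summable_on_finite_UN) (auto intro: has_sum_imp_summable)
  obtain G where G: "finite G" "G \<subseteq> ground I Om" "infsum w (ground I Om - G) < 1"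
    using summable_tail[OF s, of 1] by auto
  \<comment> \<open>A set that misses \<open>G\<close> would carry mass 1 outside \<open>G\<close>,
    where less than 1 is left. Hence every set meets \<open>G\<close>, and each point of
    \<open>G\<close> lies in only finitely many.\<close>
  have "Om k \<inter> G \<noteq> {}" if k: "k \<in> I" for k
  proof
    assume "Om k \<inter> G = {}"
    then have "infsum w (Om k) \<le> infsum w (ground I Om - G)"
      using k w by (intro infsum_mono2 summable_on_subset_banach[OF s])
        (auto simp: ground_def stochastic_def)
    then show False using infsumI[OF wk[OF k]] G(3) by simp
  qed
  then have "I \<subseteq> {k \<in> I. Om k \<inter> G \<noteq> {}}" by auto
  then show ?thesis using finite_meeting_indices[OF point_finite G(1,2)] by (rule finite_subset)
qed

lemma convex_stochastic: "convex (stochastic I Om)"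
proof (rule convexI)
  fix x y and u v :: real
  assume xy: "x \<in> stochastic I Om" "y \<in> stochastic I Om" and uv: "0 \<le> u" "0 \<le> v" "u + v = 1"
  have "((\<lambda>g. u * x g + v * y g) has_sum (u * 1 + v * 1)) (Om k)" if "k \<in> I" for k
    using xy that by (intro has_sum_add has_sum_cmult_right) (auto simp: stochastic_def)
  then show "u *\<^sub>R x + v *\<^sub>R y \<in> stochastic I Om"
    using xy uv by (auto simp: stochastic_def functions_on_def plus_fun_def)
qed

theorem theorem3p3:
  fixes I :: "nat set" and Om :: "nat \<Rightarrow> 'a set"
    and W :: "('a \<Rightarrow> real) set" and T :: "('a \<Rightarrow> real) topology"
  assumes family: "set_family I Om"
    and space: "admissible_space I Om W"
    and point_finite: "\<forall>g\<in>ground I Om. finite {k\<in>I. g \<in> Om k}"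
    and tail: "\<exists>m::nat. ground I Om = (\<Union>j\<in>{j\<in>I. j \<le> m}. Om j) \<or>
        (\<forall>k\<in>I. k > m \<longrightarrow> \<not> (\<exists>J. finite J \<and> J \<subseteq> I - {k} \<and> Om k \<subseteq> (\<Union>j\<in>J. Om j)))"
    and lc: "locally_convex_topology W T"
    and dual: "\<forall>\<phi>. continuous_functional W T \<phi> \<longrightarrow>
        (\<exists>w'\<in>dual_functions (ground I Om) W. \<forall>w\<in>W. \<phi> w = pairing (ground I Om) w w')"
    and sums: "\<forall>k\<in>I. (\<forall>w\<in>W. w summable_on Om k) \<and>
        continuous_map T euclideanreal (\<lambda>w. \<Sum>\<^sub>\<infinity>g\<in>Om k. w g)"
  shows "stochastic I Om \<inter> W \<subseteq>
           T closure_of (convex hull {w. w extreme_point_of (stochastic I Om \<inter> W)}) \<and>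
         (finer_than_pointwise (ground I Om) T \<longrightarrow>
           stochastic I Om \<inter> W =
             T closure_of (convex hull {w. w extreme_point_of (stochastic I Om \<inter> W)}))"
proof -
  let ?S = "stochastic I Om \<inter> W"
  let ?C = "convex hull {w. w extreme_point_of ?S}"
  have W: "subspace W" "W \<subseteq> functions_on (ground I Om)" using space by (auto simp: admissible_space_def)
  have top: "topspace T = W" using lc by (simp add: locally_convex_topology_def)
  have CS: "?C \<subseteq> ?S"
  proof (rule hull_minimal)
    show "convex ?S" by (intro convex_Int convex_stochastic subspace_imp_convex W)
  qed (auto simp: extreme_point_of_def)
  have pf: "finite {k \<in> I. x \<in> Om k}" if "x \<in> ground I Om" for x
    using point_finite that by blast
  have sub: "x \<in> T closure_of ?C" if x: "x \<in> ?S" for x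
  proof (rule ccontr)
    assume nx: "x \<notin> T closure_of ?C"
    obtain m where "ground I Om = (\<Union>j\<in>{j\<in>I. j \<le> m}. Om j) \<or>
        (\<forall>k\<in>I. k > m \<longrightarrow> \<not> (\<exists>J. finite J \<and> J \<subseteq> I - {k} \<and> Om k \<subseteq> (\<Union>j\<in>J. Om j)))"
      using tail by blast
    then have "\<exists>m. \<forall>k\<in>I. k > m \<longrightarrow> \<not> (\<exists>J. finite J \<and> J \<subseteq> I - {k} \<and> Om k \<subseteq> (\<Union>j\<in>J. Om j))"
    proof
      assume cover: "ground I Om = (\<Union>j\<in>{j\<in>I. j \<le> m}. Om j)"
      have "x \<in> stochastic I Om" using x by simp
      \<comment> \<open>With finitely many sets the second alternative holds vacuously beyond
        \<open>Max I\<close>.\<close>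
      from finite_index_if_finite_cover[OF this pf _ _ cover] have "finite I" by simp
      then have "\<not> Max I < k" if "k \<in> I" for k using that by (simp add: not_less)
      then show ?thesis by blast
    qed blast
    then obtain m where tail_m: "\<forall>k\<in>I. k > m \<longrightarrow> \<not> (\<exists>J. finite J \<and> J \<subseteq> I - {k} \<and> Om k \<subseteq> (\<Union>j\<in>J. Om j))"
      by (rule exE)
    have m: "\<not> Om k \<subseteq> (\<Union>j\<in>J. Om j)" if "k \<in> I" "m < k" "finite J" "J \<subseteq> I - {k}" for k J
      using tail_m that by blast
    \<comment> \<open>Pairing with the zero function serves only to produce some extreme point, so
      that the hull to be separated is nonempty.\<close>
    have zero: "(\<lambda>_. 0) \<in> dual_functions (ground I Om) W" by (simp add: dual_functions_def functions_on_def)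
    obtain v where "v extreme_point_of ?S"
      using extreme_point_almost_above[OF space zero pf m x zero_less_one] by blast
    then have C: "?C \<noteq> {}" by auto
    have "?C \<subseteq> W" "x \<in> W" using CS x by auto
    then obtain f t where f: "continuous_functional W T f" "t > 0" "\<And>c. c \<in> ?C \<Longrightarrow> f c + t \<le> f x"
      using strict_separation_point[OF lc convex_convex_hull _ C _ nx] by blast
    obtain w' where w': "w' \<in> dual_functions (ground I Om) W" "\<And>w. w \<in> W \<Longrightarrow> f w = pairing (ground I Om) w w'"
      using dual f(1) by blast
    \<comment> \<open>Half the gap suffices: this extreme point lies within \<open>t / 2\<close> of
      \<open>f x\<close> from below, while separation keeps it at distance at least
      \<open>t\<close>.\<close>
    obtain v where v: "v extreme_point_of ?S"
      "pairing (ground I Om) x w' - t / 2 \<le> pairing (ground I Om) v w'"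
      using extreme_point_almost_above[OF space w'(1) pf m x half_gt_zero[OF f(2)]] by blast
    have "v \<in> W" using v(1) by (auto simp: extreme_point_of_def)
    then have "f x - t / 2 \<le> f v" using v(2) w'(2) x by simp
    moreover have "f v + t \<le> f x" by (rule f(3)) (simp add: v(1) hull_inc)
    ultimately show False using f(2) by simp
  qed
  \<comment> \<open>Evaluations on the ground set and sums over \<open>Om k\<close> are continuous,
    so nonnegativity and unit sums pass to the closure; elsewhere members of \<open>W\<close>
    vanish.\<close>
  moreover have "T closure_of ?C \<subseteq> ?S" if fine: "finer_than_pointwise (ground I Om) T"
  proof
    fix x assume x: "x \<in> T closure_of ?C"
    have closed: "f x \<in> A" if "continuous_map T euclideanreal f" "closed A" "\<And>c. c \<in> ?S \<Longrightarrow> f c \<in> A"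
      for f :: "('a \<Rightarrow> real) \<Rightarrow> real" and A
    proof -
      have "closedin T {y \<in> topspace T. f y \<in> A}"
        using that by (intro closedin_continuous_map_preimage[of T euclideanreal]) auto
      moreover have "?C \<subseteq> {y \<in> topspace T. f y \<in> A}" using CS that(3) top by auto
      ultimately have "T closure_of ?C \<subseteq> {y \<in> topspace T. f y \<in> A}"
        by (intro closure_of_minimal)
      then show ?thesis using x by blast
    qed
    have xW: "x \<in> W" using x top by (auto simp: in_closure_of)
    have "0 \<le> x g" for g
    proof (cases "g \<in> ground I Om")
      case True
      then show ?thesis
        using closed[of "\<lambda>w. w g" "{0..}"] fine
        by (auto simp: finer_than_pointwise_def stochastic_def)
    next
      case False
      then show ?thesis using xW W(2) by (auto simp: functions_on_def)
    qed
    moreover have "(x has_sum 1) (Om k)" if k: "k \<in> I" for k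
    proof -
      have "infsum x (Om k) \<in> {1}"
        using k sums by (intro closed[of "\<lambda>w. infsum w (Om k)"]) (auto simp: stochastic_def infsumI)
      then show ?thesis using sums k xW by (simp add: has_sum_iff)
    qed
    ultimately show "x \<in> ?S" using xW W(2) by (auto simp: stochastic_def)
  qed
  ultimately show ?thesis by blast
qed

end
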